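(* Consider the plane $\sigma_3=\sigma_1+\sigma_2$ with $0<\sigma_1,\sigma_2$ and $\sigma_3<\pi$, and on it the curve $$h:=\cos(3\sigma_3)-3\cos(\sigma_3)+2\cos(2\sigma_3)\cos(\sigma_1-\sigma_2)=0 .$$ Every point of this curve is a bifurcation point between an Euler relative equilibrium on a rotating meridian ($ERE$) and a Lagrange relative equilibrium ($LRE$) for continuously many (a one-parameter continuum of) positive mass ratios $(\nu_1,\nu_2)=(m_1/m_3,m_2/m_3)$. Conversely, if for given $\nu_1,\nu_2>0$ a continuation of $LRE$ reaches the plane $\sigma_3=\sigma_1+\sigma_2$ at some point, then that point lies on the curve $h=0$; therefore it is a bifurcation point between $LRE$ and $ERE$ (for these mass ratios).
   Context: Three point masses $m_1,m_2,m_3>0$ move on the unit sphere $\mathbb{S}^2$ under the cotangent potential. A shape is a triple $(\sigma_1,\sigma_2,\sigma_3)\in U=(0,\pi)^3$, where $\sigma_k$ is the angle of the minor arc between masses $i$ and $j$, $\{i,j,k\}=\{1,2,3\}$. For $\{i,j,k\}=\{1,2,3\}$ set $$\lambda_i=\frac{(m_j+m_k)\sin^3\sigma_i-m_j\cos\sigma_k\sin^3\sigma_j-m_k\cos\sigma_j\sin^3\sigma_k}{\sin^3\sigma_i},\qquad \lambda_{ij}=\lambda_i-\lambda_j .$$ The condition for $LRE$ is $\lambda_{12}=\lambda_{23}=0$ (it depends only on the $\sigma$'s and the mass ratios). The condition for $ERE$ on a rotating meridian with $\sigma_3=\sigma_1+\sigma_2$ ($m_3$ between $m_1$ and $m_2$)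 is $d=0$, where $$d=\frac{m_1 \sin(2\sigma_2)-m_2 \sin(2\sigma_1)}{\sin^2\sigma_3}+\frac{m_2 \sin(2\sigma_3)+m_3 \sin(2\sigma_2)}{\sin^2\sigma_1}-\frac{m_3 \sin(2\sigma_1)+m_1 \sin(2\sigma_3)}{\sin^2\sigma_2}$$ with $\sigma_3=\sigma_1+\sigma_2$. For fixed masses, a continuation of $LRE$ through a point $p$ is a regular $C^1$ curve in $U$ through $p$ along which $\lambda_{12}=\lambda_{23}=0$; a continuation of $ERE$ through $p$ is a regular $C^1$ curve in the plane $\sigma_3=\sigma_1+\sigma_2$ (within $U$) through $p$ along which $d=0$. A bifurcation point of $LRE$ and $ERE$ (for given masses) is a point $p$ of the plane through which both a continuation of $LRE$ and a continuation of $ERE$ pass. *)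

theory Defs
  imports "HOL-Analysis.Analysis"
begin

text \<open>Masses and shapes are both vectors of type real^3, with component i belonging
  to index i. The shape component \<sigma>$k is the angle of the minor arc between the two masses
  other than k.\<close>

definition shape_space :: "(real^3) set" where
  "shape_space = {\<sigma>. \<forall>i. 0 < \<sigma>$i \<and> \<sigma>$i < pi}"

text \<open>The function lambda of index i, where i, j, k are meant to be pairwise distinct indices. The
  expression is symmetric in j and k, so it depends only on i.\<close>

definition lam :: "real^3 \<Rightarrow> real^3 \<Rightarrow> 3 \<Rightarrow> 3 \<Rightarrow> 3 \<Rightarrow> real" where
  "lam m \<sigma> i j k =
     ((m$j + m$k) * sin (\<sigma>$i) ^ 3 - m$j * cos (\<sigma>$k) * sin (\<sigma>$j) ^ 3
        - m$k * cos (\<sigma>$j) * sin (\<sigma>$k) ^ 3) / sin (\<sigma>$i) ^ 3"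

definition lam12 :: "real^3 \<Rightarrow> real^3 \<Rightarrow> real" where
  "lam12 m \<sigma> = lam m \<sigma> 1 2 3 - lam m \<sigma> 2 3 1"

definition lam23 :: "real^3 \<Rightarrow> real^3 \<Rightarrow> real" where
  "lam23 m \<sigma> = lam m \<sigma> 2 3 1 - lam m \<sigma> 3 1 2"

text \<open>Intersected with \<^const>\<open>shape_space\<close>, the plane is exactly the region
  0 < \<sigma>$1, 0 < \<sigma>$2, \<sigma>$3 < pi; the remaining bounds are consequences.\<close>

definition meridian_plane :: "(real^3) set" where
  "meridian_plane = {\<sigma> \<in> shape_space. \<sigma>$3 = \<sigma>$1 + \<sigma>$2}"

text \<open>The function d is only used on \<^const>\<open>meridian_plane\<close>.\<close>

definition ERE_d :: "real^3 \<Rightarrow> real^3 \<Rightarrow> real" where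
  "ERE_d m \<sigma> =
     (m$1 * sin (2 * \<sigma>$2) - m$2 * sin (2 * \<sigma>$1)) / sin (\<sigma>$3) ^ 2
     + (m$2 * sin (2 * \<sigma>$3) + m$3 * sin (2 * \<sigma>$2)) / sin (\<sigma>$1) ^ 2
     - (m$3 * sin (2 * \<sigma>$1) + m$1 * sin (2 * \<sigma>$3)) / sin (\<sigma>$2) ^ 2"

definition bif_h :: "real^3 \<Rightarrow> real" where
  "bif_h \<sigma> = cos (3 * \<sigma>$3) - 3 * cos (\<sigma>$3) + 2 * cos (2 * \<sigma>$3) * cos (\<sigma>$1 - \<sigma>$2)"

definition regular_C1_curve :: "(real \<Rightarrow> 'a::real_normed_vector) \<Rightarrow> real set \<Rightarrow> bool" where
  "regular_C1_curve \<gamma> I \<longleftrightarrow>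
     open I \<and> is_interval I \<and> I \<noteq> {} \<and> \<gamma> C1_differentiable_on I \<and>
     (\<forall>t\<in>I. vector_derivative \<gamma> (at t) \<noteq> 0)"

definition LRE_continuation :: "real^3 \<Rightarrow> (real \<Rightarrow> real^3) \<Rightarrow> real set \<Rightarrow> bool" where
  "LRE_continuation m \<gamma> I \<longleftrightarrow>
     regular_C1_curve \<gamma> I \<and> \<gamma> ` I \<subseteq> shape_space \<and>
     (\<forall>t\<in>I. lam12 m (\<gamma> t) = 0 \<and> lam23 m (\<gamma> t) = 0)"

definition ERE_continuation :: "real^3 \<Rightarrow> (real \<Rightarrow> real^3) \<Rightarrow> real set \<Rightarrow> bool" where
  "ERE_continuation m \<gamma> I \<longleftrightarrow>
     regular_C1_curve \<gamma> I \<and> \<gamma> ` I \<subseteq> meridian_plane \<and> (\<forall>t\<in>I. ERE_d m (\<gamma> t) = 0)"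

definition bifurcation_point :: "real^3 \<Rightarrow> real^3 \<Rightarrow> bool" where
  "bifurcation_point m p \<longleftrightarrow>
     p \<in> meridian_plane \<and>
     (\<exists>\<gamma> I. LRE_continuation m \<gamma> I \<and> p \<in> \<gamma> ` I) \<and>
     (\<exists>\<gamma> I. ERE_continuation m \<gamma> I \<and> p \<in> \<gamma> ` I)"

definition masses_with_ratios :: "real \<times> real \<Rightarrow> (real^3) set" where
  "masses_with_ratios \<nu> =
     {m. (\<forall>i. 0 < m$i) \<and> m$1 / m$3 = fst \<nu> \<and> m$2 / m$3 = snd \<nu>}"

end

theory Submission
  imports Defs
begin

text \<open>Write T_i = sin^3 \<sigma>_i, let G be the Gram matrix of the three positions, and put
  y_i = m_i T_i and M = m_1 + m_2 + m_3. Then M - \<lambda>_i = (G y)_i / T_i, so the Lagrange condition says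
  that G y = (M - \<lambda>) T for a single number \<lambda>. On the plane \<sigma>_3 = \<sigma>_1 + \<sigma>_2 the positions lie on a great
  circle, G has rank two, and its kernel is spanned by (sin \<sigma>_1, sin \<sigma>_2, - sin \<sigma>_3). Pairing with this
  kernel vector gives (M - \<lambda>) (sin^4 \<sigma>_1 + sin^4 \<sigma>_2 - sin^4 \<sigma>_3) = 0
  (\<open>weighted_lam_meridian\<close>). Here \<lambda> = M is impossible, since y would lie in the kernel, whose vectors
  do not have three positive entries (\<open>lam_neq_total_mass\<close>). What remains is
  sin^4 \<sigma>_1 + sin^4 \<sigma>_2 = sin^4 \<sigma>_3, and the difference of the two sides is
  sin \<sigma>_1 sin \<sigma>_2 h / 2 (\<open>meridian_h_factor\<close>). So Lagrange shapes in the plane lie on h = 0.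
  Conversely, on h = 0 the two Lagrange equations reduce to one linear equation in the masses, which
  is also the Euler equation d = 0 (\<open>meridian_d_lam12\<close>). Its coefficients of m_1 and m_2 have opposite
  signs, hence it has a one-parameter family of positive mass ratios.

  It remains to produce the curves, by the implicit function theorem in three-space
  (\<open>regular_curve_through_common_zero\<close>).

  For the Lagrange curve, differentiating the paired identity within the plane at a point of h = 0
  shows that the determinant of the in-plane derivatives of \<lambda>_12 and \<lambda>_23 is, up to a nonzero factor,
  the derivative of \<lambda>_12 along the tangent of h = 0. That derivative is linear in the masses. It cannot
  vanish on all solutions of the mass equation, because the ratio of the first two coefficients of
  \<lambda>_12 has nonzero speed along the curve (\<open>lam12_coeff_wedge\<close>). So at most one ratio on the solution
  line is exceptional, and a suitable segment of the line avoids it.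

  The Euler curve is needed for every positive solution of the mass equation. If
  \<sigma>_1 = \<sigma>_2, then m_1 = m_2 and d vanishes on the isosceles shapes. Otherwise the derivative of d at
  fixed \<sigma>_1 - \<sigma>_2 is nonzero (\<open>meridian_d_transversal\<close>): it suffices to determine its sign on the two
  extreme rays of the cone of nonnegative solutions. On one of them the sign is that of a quartic polynomial in cos^2 \<sigma>_3, because on h = 0 both
  sin \<sigma>_1 sin \<sigma>_2 and sin^2 \<sigma>_1 + sin^2 \<sigma>_2 depend on cos \<sigma>_3 only, which lies between -1/3 and 0; on the other all terms
  have the same sign.\<close>

section \<open>Scalar functions with a continuous gradient\<close>

text \<open>The gradient is represented by a vector field rather than by a family of linear maps, so that
  its continuity can be stated in the vector space itself and cross products of gradients make sense.\<close>

definition C1_scalar_on :: "('a::real_inner \<Rightarrow> real) \<Rightarrow> 'a set \<Rightarrow> bool" where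
  "C1_scalar_on f U \<longleftrightarrow>
     (\<exists>G. continuous_on U G \<and> (\<forall>x\<in>U. (f has_derivative (\<lambda>h. G x \<bullet> h)) (at x)))"

lemma C1_scalar_on_const: "C1_scalar_on (\<lambda>x::'a::real_inner. c) U"
proof -
  have "(\<bullet>) (0::'a) = (\<lambda>h. 0)" by auto
  then show ?thesis unfolding C1_scalar_on_def
    by (intro exI[of _ "\<lambda>x. 0"]) auto
qed

lemma C1_scalar_on_inner: "C1_scalar_on (\<lambda>x. w \<bullet> x) U"
  unfolding C1_scalar_on_def by (intro exI[of _ "\<lambda>x. w"]) (auto intro!: derivative_eq_intros)

lemma C1_scalar_on_nth: "C1_scalar_on (\<lambda>x::real^'n. x $ i) U"
  using C1_scalar_on_inner[of "axis i 1" U] by (simp add: cart_eq_inner_axis inner_commute)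

lemma C1_scalar_on_continuous: "C1_scalar_on f U \<Longrightarrow> continuous_on U f"
  unfolding C1_scalar_on_def
  by (meson continuous_at_imp_continuous_on has_derivative_continuous)

lemma C1_scalar_on_compose:
  fixes f :: "'a::real_inner \<Rightarrow> real"
  assumes f: "C1_scalar_on f U"
    and \<phi>: "\<And>x. x \<in> U \<Longrightarrow> (\<phi> has_real_derivative \<phi>' (f x)) (at (f x))"
    and c: "continuous_on U (\<lambda>x. \<phi>' (f x))"
  shows "C1_scalar_on (\<lambda>x. \<phi> (f x)) U"
proof -
  obtain G where G: "continuous_on U G" "\<And>x. x \<in> U \<Longrightarrow> (f has_derivative (\<lambda>h. G x \<bullet> h)) (at x)"
    using f unfolding C1_scalar_on_def by blast
  have "((\<lambda>x. \<phi> (f x)) has_derivative (\<lambda>h. (\<phi>' (f x) *\<^sub>R G x) \<bullet> h)) (at x)" if "x \<in> U" for x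
    using has_derivative_compose[OF G(2)[OF that] \<phi>[OF that, unfolded has_field_derivative_def]]
    by simp
  then show ?thesis unfolding C1_scalar_on_def
    using continuous_on_scaleR[OF c G(1)] by blast
qed

lemma C1_scalar_on_sin: "C1_scalar_on f U \<Longrightarrow> C1_scalar_on (\<lambda>x. sin (f x)) U"
  by (rule C1_scalar_on_compose[where f = f and \<phi> = sin and \<phi>' = cos])
    (auto intro!: derivative_eq_intros continuous_intros dest: C1_scalar_on_continuous)

lemma C1_scalar_on_cos: "C1_scalar_on f U \<Longrightarrow> C1_scalar_on (\<lambda>x. cos (f x)) U"
  by (rule C1_scalar_on_compose[where f = f and \<phi> = cos and \<phi>' = "\<lambda>y. - sin y"])
    (auto intro!: derivative_eq_intros continuous_intros dest: C1_scalar_on_continuous)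

lemma C1_scalar_on_power: "C1_scalar_on f U \<Longrightarrow> C1_scalar_on (\<lambda>x. f x ^ n) U"
  by (rule C1_scalar_on_compose[where f = f and \<phi> = "\<lambda>y. y ^ n" and \<phi>' = "\<lambda>y. of_nat n * y ^ (n - 1)"])
    (auto intro!: derivative_eq_intros continuous_intros dest: C1_scalar_on_continuous)

lemma C1_scalar_on_inverse:
  "C1_scalar_on f U \<Longrightarrow> (\<And>x. x \<in> U \<Longrightarrow> f x \<noteq> 0) \<Longrightarrow> C1_scalar_on (\<lambda>x. inverse (f x)) U"
  by (rule C1_scalar_on_compose[where f = f and \<phi> = inverse and \<phi>' = "\<lambda>y. - (inverse y ^ 2)"])
    (auto intro!: derivative_eq_intros continuous_intros dest: C1_scalar_on_continuous simp: power2_eq_square)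

lemma C1_scalar_on_add:
  assumes "C1_scalar_on f U" "C1_scalar_on g U"
  shows "C1_scalar_on (\<lambda>x. f x + g x) U"
proof -
  obtain F G where "continuous_on U F" "\<And>x. x \<in> U \<Longrightarrow> (f has_derivative (\<lambda>h. F x \<bullet> h)) (at x)"
    "continuous_on U G" "\<And>x. x \<in> U \<Longrightarrow> (g has_derivative (\<lambda>h. G x \<bullet> h)) (at x)"
    using assms unfolding C1_scalar_on_def by blast
  then show ?thesis unfolding C1_scalar_on_def
    by (intro exI[of _ "\<lambda>x. F x + G x"])
      (auto intro!: continuous_intros derivative_eq_intros simp: inner_add_left)
qed

lemma C1_scalar_on_mult:
  assumes "C1_scalar_on f U" "C1_scalar_on g U"
  shows "C1_scalar_on (\<lambda>x. f x * g x) U"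
proof -
  obtain F G where "continuous_on U F" "\<And>x. x \<in> U \<Longrightarrow> (f has_derivative (\<lambda>h. F x \<bullet> h)) (at x)"
    "continuous_on U G" "\<And>x. x \<in> U \<Longrightarrow> (g has_derivative (\<lambda>h. G x \<bullet> h)) (at x)"
    using assms unfolding C1_scalar_on_def by blast
  then show ?thesis unfolding C1_scalar_on_def
    using assms[THEN C1_scalar_on_continuous]
    by (intro exI[of _ "\<lambda>x. f x *\<^sub>R G x + g x *\<^sub>R F x"])
      (auto intro!: continuous_intros derivative_eq_intros simp: inner_add_left)
qed

lemma C1_scalar_on_diff:
  assumes "C1_scalar_on f U" "C1_scalar_on g U"
  shows "C1_scalar_on (\<lambda>x. f x - g x) U"
  using C1_scalar_on_add[OF assms(1) C1_scalar_on_mult[OF C1_scalar_on_const[of "-1"] assms(2)]]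
  by simp

lemma C1_scalar_on_divide:
  assumes "C1_scalar_on f U" "C1_scalar_on g U" "\<And>x. x \<in> U \<Longrightarrow> g x \<noteq> 0"
  shows "C1_scalar_on (\<lambda>x. f x / g x) U"
  unfolding divide_inverse
  by (rule C1_scalar_on_mult[OF assms(1) C1_scalar_on_inverse[OF assms(2,3)]])

lemmas C1_scalar_on_intros = C1_scalar_on_const C1_scalar_on_nth C1_scalar_on_sin C1_scalar_on_cos
  C1_scalar_on_power C1_scalar_on_add C1_scalar_on_mult C1_scalar_on_diff C1_scalar_on_divide

lemma has_real_derivative_along_line:
  assumes "(f has_derivative (\<lambda>h. g \<bullet> h)) (at p)"
  shows "((\<lambda>t. f (p + t *\<^sub>R v)) has_real_derivative (g \<bullet> v)) (at 0)"
proof -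
  have "((\<lambda>t::real. p + t *\<^sub>R v) has_derivative (\<lambda>t. t *\<^sub>R v)) (at 0)"
    by (auto intro!: derivative_eq_intros)
  then have "((\<lambda>t. f (p + t *\<^sub>R v)) has_derivative (\<lambda>t. g \<bullet> (t *\<^sub>R v))) (at 0)"
    using has_derivative_compose[of "\<lambda>t. p + t *\<^sub>R v" "\<lambda>t. t *\<^sub>R v" 0 UNIV f "\<lambda>h. g \<bullet> h"] assms
    by simp
  then show ?thesis
    by (simp add: has_field_derivative_def mult.commute[of _ "g \<bullet> v"])
qed

lemma C1_scalar_on_directional_derivative:
  assumes "C1_scalar_on f U" "p \<in> U"
  obtains d where "((\<lambda>t. f (p + t *\<^sub>R v)) has_real_derivative d) (at 0)"
  using assms has_real_derivative_along_line unfolding C1_scalar_on_def by blast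

section \<open>Curves of common zeros in three-space\<close>

context
  includes cross3_syntax
begin

text \<open>Cramer's rule in vector form. It gives the explicit inverse of the linear map with rows a, b, c,
  and it identifies a vector annihilated by a and b as a multiple of their cross product.\<close>

lemma cross3_frame_expansion:
  fixes a b c v :: "real^3"
  shows "(c \<bullet> (a \<times> b)) *\<^sub>R v =
           (a \<bullet> v) *\<^sub>R (b \<times> c) + (b \<bullet> v) *\<^sub>R (c \<times> a) + (c \<bullet> v) *\<^sub>R (a \<times> b)"
  by (simp add: cross3_simps forall_3)

text \<open>The implicit function theorem for two equations in three unknowns. Independence of the two
  gradients is expressed by a nonzero minor of directional derivatives, because such derivatives
  are what one computes along explicit lines.\<close>

lemma regular_curve_through_common_zero:
  fixes f1 f2 :: "real^3 \<Rightarrow> real"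
  assumes U: "open U" "p \<in> U"
    and C1: "C1_scalar_on f1 U" "C1_scalar_on f2 U"
    and zero: "f1 p = 0" "f2 p = 0"
    and der: "((\<lambda>t. f1 (p + t *\<^sub>R v)) has_real_derivative a1) (at 0)"
             "((\<lambda>t. f2 (p + t *\<^sub>R v)) has_real_derivative a2) (at 0)"
             "((\<lambda>t. f1 (p + t *\<^sub>R w)) has_real_derivative b1) (at 0)"
             "((\<lambda>t. f2 (p + t *\<^sub>R w)) has_real_derivative b2) (at 0)"
    and indep: "a1 * b2 - a2 * b1 \<noteq> 0"
  shows "\<exists>\<gamma> I. regular_C1_curve \<gamma> I \<and> \<gamma> ` I \<subseteq> U \<and> p \<in> \<gamma> ` I \<and>
           (\<forall>t\<in>I. f1 (\<gamma> t) = 0 \<and> f2 (\<gamma> t) = 0)"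
proof -
  obtain G1 where G1: "continuous_on U G1"
      "\<And>x. x \<in> U \<Longrightarrow> (f1 has_derivative (\<lambda>h. G1 x \<bullet> h)) (at x)"
    using C1(1) unfolding C1_scalar_on_def by blast
  obtain G2 where G2: "continuous_on U G2"
      "\<And>x. x \<in> U \<Longrightarrow> (f2 has_derivative (\<lambda>h. G2 x \<bullet> h)) (at x)"
    using C1(2) unfolding C1_scalar_on_def by blast
  have dir: "c = g \<bullet> u"
    if "(f has_derivative (\<lambda>h. g \<bullet> h)) (at p)"
      "((\<lambda>t. f (p + t *\<^sub>R u)) has_real_derivative c) (at 0)" for f :: "real^3 \<Rightarrow> real" and g u c
    using DERIV_unique[OF that(2) has_real_derivative_along_line[OF that(1)]] .
  define k where "k = G1 p \<times> G2 p"
  have "k \<bullet> (v \<times> w) = a1 * b2 - a2 * b1"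
    using dir[OF G1(2)[OF U(2)] der(1)] dir[OF G2(2)[OF U(2)] der(2)]
      dir[OF G1(2)[OF U(2)] der(3)] dir[OF G2(2)[OF U(2)] der(4)]
    by (simp add: k_def dot_cross algebra_simps)
  then have "k \<noteq> 0" using indep by auto
  define det where "det x = k \<bullet> (G1 x \<times> G2 x)" for x
  define V where "V = {x \<in> U. det x \<noteq> 0}"
  have contdet: "continuous_on U det"
    unfolding det_def using G1 G2 by (intro continuous_intros continuous_on_cross)
  have V: "open V" "p \<in> V" "V \<subseteq> U"
  proof -
    have "V = U \<inter> det -` (- {0})" by (auto simp: V_def)
    then show "open V"
      using continuous_open_preimage[OF contdet U(1), of "-{0}"]
      by (simp add: open_Compl)
    show "p \<in> V" using U(2) \<open>k \<noteq> 0\<close> by (simp add: V_def det_def k_def[symmetric])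
    show "V \<subseteq> U" by (auto simp: V_def)
  qed
  \<comment> \<open>Adding the coordinate along the gradients' cross product makes the map locally invertible;
      the curve is the preimage of the line on which the first two components vanish.\<close>
  define F :: "real^3 \<Rightarrow> real^3"
    where "F x = f1 x *\<^sub>R axis 1 1 + f2 x *\<^sub>R axis 2 1 + (k \<bullet> x) *\<^sub>R axis 3 1" for x
  define L where "L x h = (G1 x \<bullet> h) *\<^sub>R axis 1 1 + (G2 x \<bullet> h) *\<^sub>R axis 2 1
      + (k \<bullet> h) *\<^sub>R (axis 3 1 :: real^3)" for x h
  have bl: "bounded_linear (L x)" for x
    unfolding L_def by (intro bounded_linear_intros)
  define F' where "F' x = Blinfun (L x)" for x
  have F'[simp]: "blinfun_apply (F' x) = L x" for x
    by (simp add: F'_def bounded_linear_Blinfun_apply bl)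
  have derF: "(F has_derivative blinfun_apply (F' x)) (at x)" if "x \<in> V" for x
    unfolding F' F_def L_def
    using G1(2) G2(2) that V(3) by (auto intro!: derivative_eq_intros)
  have contF': "continuous_on V F'"
  proof (rule continuous_on_blinfun_componentwise)
    fix i :: "real^3" assume "i \<in> Basis"
    show "continuous_on V (\<lambda>x. blinfun_apply (F' x) i)"
      unfolding F' L_def using V(3) G1(1) G2(1)
      by (intro continuous_intros) (auto intro: continuous_on_subset)
  qed
  define J where "J y = (1 / det p) *\<^sub>R ((y$1) *\<^sub>R (G2 p \<times> k) + (y$2) *\<^sub>R (k \<times> G1 p)
      + (y$3) *\<^sub>R (G1 p \<times> G2 p))" for y :: "real^3"
  have "bounded_linear J"
    unfolding J_def by (intro bounded_linear_intros bounded_linear_vec_nth)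
  then have "Blinfun J o\<^sub>L F' p = id_blinfun"
  proof (intro blinfun_eqI)
    fix h
    have "J (L p h) = h"
      using V(2) cross3_frame_expansion[of k "G1 p" "G2 p" h, symmetric]
      by (simp add: J_def L_def V_def det_def axis_def)
    then show "blinfun_apply (Blinfun J o\<^sub>L F' p) h = blinfun_apply id_blinfun h"
      using \<open>bounded_linear J\<close> by (simp add: bounded_linear_Blinfun_apply)
  qed
  note left_inverse = this
  obtain U' V' g g' where inv: "open U'" "U' \<subseteq> V" "p \<in> U'" "open V'" "F p \<in> V'"
      "homeomorphism U' V' F g" "\<And>y. y \<in> V' \<Longrightarrow> (g has_derivative (g' y)) (at y)"
    by (rule inverse_function_theorem[OF V(1) derF contF' V(2) left_inverse]) blast+
  define l where "l t = F p + t *\<^sub>R (axis 3 1 :: real^3)" for t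
  obtain e where e: "e > 0" "ball (F p) e \<subseteq> V'"
    using inv(4,5) open_contains_ball by blast
  define I where "I = {-e<..<e}"
  define \<gamma> where "\<gamma> t = g (l t)" for t
  have lV: "l t \<in> V'" if "t \<in> I" for t
    using that e(2) by (force simp: I_def l_def dist_norm)
  have \<gamma>U': "\<gamma> t \<in> U'" and F\<gamma>: "F (\<gamma> t) = l t" if "t \<in> I" for t
    using inv(6) lV[OF that] unfolding \<gamma>_def homeomorphism_def by blast+
  have coords: "F x $ 1 = f1 x" "F x $ 2 = f2 x" "F x $ 3 = k \<bullet> x"
      "L x h $ 1 = G1 x \<bullet> h" "L x h $ 2 = G2 x \<bullet> h" "L x h $ 3 = k \<bullet> h" for x h
    by (simp_all add: F_def L_def axis_def)
  \<comment> \<open>A tangent is orthogonal to both gradients and has k-component 1, which determines it;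
      this explicit form also shows that the tangent is continuous.\<close>
  define T where "T x = (1 / det x) *\<^sub>R (G1 x \<times> G2 x)" for x
  have \<gamma>': "(\<gamma> has_vector_derivative T (\<gamma> t)) (at t)" and kT: "k \<bullet> T (\<gamma> t) = 1" if "t \<in> I" for t
  proof -
    have lder: "(l has_vector_derivative axis 3 1) (at t)"
      unfolding l_def by (auto intro!: derivative_eq_intros)
    have "(\<gamma> has_vector_derivative g' (l t) (axis 3 1)) (at t)"
      using has_derivative_compose[OF lder[unfolded has_vector_derivative_def] inv(7)[OF lV[OF that]]]
        linear_scale[OF has_derivative_linear[OF inv(7)[OF lV[OF that]]]]
      unfolding \<gamma>_def has_vector_derivative_def by simp
    moreover define u where "u = g' (l t) (axis 3 1)"
    ultimately have u: "(\<gamma> has_vector_derivative u) (at t)" by simp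
    have x: "\<gamma> t \<in> V" using \<gamma>U'[OF that] inv(2) by blast
    have "linear (L (\<gamma> t))" using bl bounded_linear.linear by blast
    then have "((\<lambda>t. F (\<gamma> t)) has_vector_derivative L (\<gamma> t) u) (at t)"
      using has_derivative_compose[OF u[unfolded has_vector_derivative_def] derF[OF x]]
      unfolding has_vector_derivative_def by (simp add: linear_scale)
    moreover have "((\<lambda>t. F (\<gamma> t)) has_vector_derivative axis 3 1) (at t)"
    proof (rule has_vector_derivative_transform_within_open[OF lder, of I])
      show "open I" by (simp add: I_def)
    qed (use that F\<gamma> in auto)
    ultimately have "L (\<gamma> t) u = axis 3 1" by (rule vector_derivative_unique_at)
    then have "G1 (\<gamma> t) \<bullet> u = 0" "G2 (\<gamma> t) \<bullet> u = 0" and ku: "k \<bullet> u = 1"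
      using coords(4-6)[of "\<gamma> t" u] by (auto simp: axis_def)
    then have "G1 (\<gamma> t) \<times> G2 (\<gamma> t) = det (\<gamma> t) *\<^sub>R u"
      unfolding det_def cross3_frame_expansion by simp
    then have "u = T (\<gamma> t)" using x by (simp add: T_def V_def)
    then show "(\<gamma> has_vector_derivative T (\<gamma> t)) (at t)" "k \<bullet> T (\<gamma> t) = 1" using u ku by auto
  qed
  have "continuous_on V T"
    unfolding T_def
  proof (rule continuous_on_scaleR)
    show "continuous_on V (\<lambda>x. 1 / det x)"
      using continuous_on_subset[OF contdet V(3)] by (intro continuous_intros) (auto simp: V_def)
    show "continuous_on V (\<lambda>x. G1 x \<times> G2 x)"
      by (rule continuous_on_cross[OF G1(1)[THEN continuous_on_subset, OF V(3)]
            G2(1)[THEN continuous_on_subset, OF V(3)]])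
  qed
  moreover have "continuous_on I \<gamma>"
    by (intro continuous_at_imp_continuous_on ballI)
      (rule has_vector_derivative_continuous[OF \<gamma>'])
  moreover have "\<gamma> ` I \<subseteq> V"
    using \<gamma>U' inv(2) by blast
  ultimately have "continuous_on I (\<lambda>t. T (\<gamma> t))"
    by (rule continuous_on_compose2)
  then have "\<gamma> C1_differentiable_on I"
    unfolding C1_differentiable_on_def using \<gamma>' by (intro exI[of _ "\<lambda>t. T (\<gamma> t)"]) simp
  moreover have "vector_derivative \<gamma> (at t) \<noteq> 0" if "t \<in> I" for t
  proof
    assume "vector_derivative \<gamma> (at t) = 0"
    then have "T (\<gamma> t) = 0"
      using vector_derivative_at[OF \<gamma>'[OF that]] by simp
    with kT[OF that] show False by simp
  qed
  moreover have "0 \<in> I" using e by (simp add: I_def)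
  ultimately have "regular_C1_curve \<gamma> I"
    unfolding regular_C1_curve_def by (auto simp: I_def is_interval_oo)
  moreover have "\<gamma> 0 = p"
    using inv(3,6) by (simp add: \<gamma>_def l_def homeomorphism_def)
  moreover have "f1 (\<gamma> t) = 0 \<and> f2 (\<gamma> t) = 0" if "t \<in> I" for t
    using arg_cong[OF F\<gamma>[OF that], of "\<lambda>y. y $ 1"] arg_cong[OF F\<gamma>[OF that], of "\<lambda>y. y $ 2"] zero
    by (simp add: coords l_def axis_def)
  moreover have "\<gamma> ` I \<subseteq> U"
    using \<gamma>U' inv(2) V(3) by blast
  ultimately show ?thesis
    using \<open>0 \<in> I\<close> by blast
qed

end

section \<open>The bifurcation curve in the meridian plane\<close>

definition meridian_h :: "real \<Rightarrow> real \<Rightarrow> real" where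
  "meridian_h a b = cos (3 * (a + b)) - 3 * cos (a + b) + 2 * cos (2 * (a + b)) * cos (a - b)"

lemma sin_squares_plane: "sin a ^ 2 + sin b ^ 2 = 1 - cos (a + b) * cos (a - b)" for a b :: real
  unfolding cos_add cos_diff using sin_cos_squared_add[of a] sin_cos_squared_add[of b]
  by algebra

lemma sin_squares_diff: "sin a ^ 2 - sin b ^ 2 = sin (a + b) * sin (a - b)" for a b :: real
  unfolding sin_add sin_diff using sin_cos_squared_add[of a] sin_cos_squared_add[of b]
  by algebra

lemma meridian_h_cos:
  "meridian_h a b = 4 * cos (a + b) ^ 3 - 6 * cos (a + b)
      + 2 * (2 * cos (a + b) ^ 2 - 1) * cos (a - b)"
  unfolding meridian_h_def cos_treble_cos cos_double_cos by simp

text \<open>In terms of C = cos (a + b) and K = cos (a - b) one has sin a sin b = (K - C) / 2 and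
  sin^2 a + sin^2 b = 1 - C K, so the left-hand side is a polynomial in C and K, which K - C divides.\<close>

lemma meridian_h_factor:
  "sin a ^ 4 + sin b ^ 4 - sin (a + b) ^ 4 = sin a * sin b * meridian_h a b / 2"
proof -
  define C K P Q where d: "C = cos (a + b)" "K = cos (a - b)" "P = sin a * sin b" "Q = sin a ^ 2 + sin b ^ 2"
  have P: "P = (K - C) / 2" and Q: "Q = 1 - C * K"
    unfolding d by (simp_all add: sin_times_sin sin_squares_plane)
  have "sin (a + b) ^ 4 = (1 - C ^ 2) ^ 2"
    using sin_squared_eq[of "a + b"] by (simp add: d) algebra
  moreover have "sin a ^ 4 + sin b ^ 4 = Q ^ 2 - 2 * P ^ 2"
    unfolding d by algebra
  ultimately have "sin a ^ 4 + sin b ^ 4 - sin (a + b) ^ 4 = (1 - C * K) ^ 2 - 2 * ((K - C) / 2) ^ 2 - (1 - C ^ 2) ^ 2"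
    using P Q by simp
  also have "\<dots> = (K - C) / 2 * (4 * C ^ 3 - 6 * C + 2 * (2 * C ^ 2 - 1) * K) / 2"
    by (simp add: field_simps) algebra
  also have "\<dots> = sin a * sin b * meridian_h a b / 2"
    unfolding meridian_h_cos using P unfolding d by simp
  finally show ?thesis .
qed

text \<open>A point of the curve h = 0, with coordinates a = \<sigma>_1 and b = \<sigma>_2.\<close>

locale bifurcation_shape =
  fixes a b :: real
  assumes pos: "0 < a" "0 < b" "a + b < pi"
    and on_curve: "meridian_h a b = 0"
begin

text \<open>The sign of \<kappa> makes it positive on the whole curve, and W is - cos (2 (a + b)). The equation
  of the curve is W K = \<kappa> (2 + W), so K, sin a sin b and sin^2 a + sin^2 b become
  rational functions of \<kappa>.\<close>

definition \<kappa> where "\<kappa> = - cos (a + b)"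
definition W where "W = 1 - 2 * \<kappa> ^ 2"
definition K where "K = cos (a - b)"
definition S where "S = sin (a + b)"
definition s where "s = sin (a - b)"

lemma sin_pos: "0 < sin a" "0 < sin b" "0 < S"
  using pos unfolding S_def by (auto intro: sin_gt_zero)

lemma S_squared: "S ^ 2 = 1 - \<kappa> ^ 2"
  by (simp add: S_def \<kappa>_def sin_squared_eq)

text \<open>The constraints -\<kappa> < K \<le> 1, which say that sin a sin b > 0 and that K is a cosine, cut
  out this range of \<kappa>. The upper bound comes from K = 1, where \<kappa> is a root of
  2 \<kappa>^2 - 4 \<kappa> + 1; its smaller root, about 0.293, is replaced by 1/3.\<close>

lemma
  shows kappa_pos: "0 < \<kappa>" and kappa_less: "\<kappa> < 1 / 3" and W_K: "W * K = \<kappa> * (2 + W)"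
proof -
  have K1: "K \<le> 1" by (simp add: K_def)
  have p: "0 < K + \<kappa>"
    using sin_pos mult_pos_pos[of "sin a" "sin b"] by (simp add: sin_times_sin K_def \<kappa>_def)
  have s: "\<kappa> ^ 2 < 1" using S_squared sin_pos(3) by (smt (verit) zero_less_power)
  then have k1: "-1 < \<kappa>" "\<kappa> < 1" by (auto simp: abs_square_less_1)
  have eq: "(1 - 2 * \<kappa> ^ 2) * K = \<kappa> * (3 - 2 * \<kappa> ^ 2)"
    using on_curve unfolding meridian_h_cos K_def \<kappa>_def by (simp add: algebra_simps power3_eq_cube power2_eq_square)
  show "W * K = \<kappa> * (2 + W)" unfolding W_def using eq by simp
  have "W > 0"
  proof (rule ccontr)
    assume n: "\<not> 0 < W"
    show False
    proof (cases "\<kappa> > 0")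
      case True
      have "W * (K + \<kappa>) = 2 * \<kappa> * (1 + W)"
        using eq unfolding W_def by algebra
      moreover have "1 + W > 0" using s by (simp add: W_def)
      ultimately have "W * (K + \<kappa>) > 0" using True by simp
      then show False using n p by (simp add: zero_less_mult_iff)
    next
      case False
      have "(W * (K - 1)) = (1 + \<kappa>) * (- (1 - 4 * \<kappa> + 2 * \<kappa> ^ 2))"
        using eq unfolding W_def by algebra
      moreover have "1 - 4 * \<kappa> + 2 * \<kappa> ^ 2 > 0" using False zero_le_power2[of \<kappa>] by linarith
      moreover have "W * (K - 1) \<ge> 0"
        using n K1 by (simp add: mult_nonpos_nonpos)
      ultimately show False using k1 by (simp add: zero_le_mult_iff)
    qed
  qed
  have f: "(W * (1 - K)) = (1 + \<kappa>) * (1 - 4 * \<kappa> + 2 * \<kappa> ^ 2)"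
    using eq unfolding W_def by algebra
  have "W * (1 - K) \<ge> 0" using \<open>W > 0\<close> K1 by simp
  then have g: "1 - 4 * \<kappa> + 2 * \<kappa> ^ 2 \<ge> 0" using f k1 by (simp add: zero_le_mult_iff)
  show "\<kappa> < 1 / 3"
  proof (rule ccontr)
    assume "\<not> \<kappa> < 1 / 3"
    then have "(\<kappa> - 1 / 3) * (\<kappa> - 1) \<le> 0" using k1 by (simp add: mult_nonneg_nonpos)
    then have "\<kappa> ^ 2 \<le> 4 / 3 * \<kappa> - 1 / 3" by (simp add: field_simps power2_eq_square)
    then show False using g \<open>\<not> \<kappa> < 1 / 3\<close> by simp
  qed
  show "0 < \<kappa>"
  proof (rule ccontr)
    assume n: "\<not> 0 < \<kappa>"
    have "W * (K + \<kappa>) > 0" using \<open>W > 0\<close> p by simp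
    moreover have "W * (K + \<kappa>) = \<kappa> * (2 + 2 * W)"
      using eq unfolding W_def by algebra
    ultimately show False using n \<open>W > 0\<close> by (simp add: zero_less_mult_iff)
  qed
qed

lemma kappa_squared_less: "\<kappa> ^ 2 < 1 / 9"
  using power_strict_mono[of \<kappa> "1/3" 2] kappa_pos kappa_less by (simp add: power2_eq_square)

lemma W_bound: "7 / 9 < W"
  using kappa_squared_less by (simp add: W_def)

lemma K_pos: "0 < K"
proof -
  have "0 < W * K" unfolding W_K using kappa_pos W_bound by (intro mult_pos_pos) auto
  then show ?thesis using W_bound by (simp add: zero_less_mult_iff)
qed

lemma prod_sin: "W * (sin a * sin b) = 2 * \<kappa> * S ^ 2"
proof -
  have "W * (sin a * sin b) = (W * K + W * \<kappa>) / 2"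
    by (simp add: sin_times_sin K_def \<kappa>_def algebra_simps)
  then show ?thesis unfolding W_K S_squared by (simp add: W_def field_simps)
qed

lemma sum_sin_squares: "W * (sin a ^ 2 + sin b ^ 2) = S ^ 2 * (1 + 2 * \<kappa> ^ 2)"
proof -
  have "W * (sin a ^ 2 + sin b ^ 2) = W + \<kappa> * (W * K)"
    by (simp add: sin_squares_plane K_def \<kappa>_def algebra_simps)
  then have "W * (sin a ^ 2 + sin b ^ 2) = W + \<kappa> * (\<kappa> * (2 + W))" unfolding W_K .
  then show ?thesis unfolding S_squared W_def by algebra
qed

lemma quartic: "sin a ^ 4 + sin b ^ 4 = S ^ 4"
  using meridian_h_factor[of a b] on_curve by (simp add: S_def)

end

lemma bifurcation_shape_swap: "bifurcation_shape a b \<Longrightarrow> bifurcation_shape b a"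
  unfolding bifurcation_shape_def meridian_h_def
  by (simp add: add.commute cos_diff mult.commute)

section \<open>Transversality of the Lagrange condition\<close>

text \<open>The coefficients of the masses in \<lambda>_1 - \<lambda>_2 on the plane \<sigma>_3 = \<sigma>_1 + \<sigma>_2.\<close>

definition lam12_coeff1 :: "real \<Rightarrow> real \<Rightarrow> real" where
  "lam12_coeff1 a b = cos (a + b) * (sin a / sin b) ^ 3 - 1"

definition lam12_coeff2 :: "real \<Rightarrow> real \<Rightarrow> real" where
  "lam12_coeff2 a b = 1 - cos (a + b) * (sin b / sin a) ^ 3"

definition lam12_coeff3 :: "real \<Rightarrow> real \<Rightarrow> real" where
  "lam12_coeff3 a b = cos a * (sin (a + b) / sin b) ^ 3 - cos b * (sin (a + b) / sin a) ^ 3"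

context bifurcation_shape
begin

lemma meridian_h_deriv:
  "((\<lambda>t. meridian_h (a + t * x) (b + t * y)) has_real_derivative
      2 * (S * (3 * W + 4 * \<kappa> * K)) * (x + y) + 2 * (W * s) * (x - y)) (at 0)"
  unfolding meridian_h_cos
  by (rule derivative_eq_intros refl)+
    (simp add: S_def W_def \<kappa>_def K_def s_def algebra_simps power2_eq_square)

text \<open>A tangent vector of h = 0, obtained by rotating the gradient of h in the coordinates
  a + b and a - b.\<close>

definition tangent1 where "tangent1 = (S * (3 * W + 4 * \<kappa> * K) - W * s) / 2"
definition tangent2 where "tangent2 = (- S * (3 * W + 4 * \<kappa> * K) - W * s) / 2"

lemma meridian_h_tangent:
  "((\<lambda>t. meridian_h (a + t * tangent1) (b + t * tangent2)) has_real_derivative 0) (at 0)"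
  using meridian_h_deriv[of tangent1 tangent2] unfolding tangent1_def tangent2_def by (simp add: field_simps)

lemma lam12_coeff1_deriv:
  "((\<lambda>t. lam12_coeff1 (a + t * x) (b + t * y)) has_real_derivative
     (sin a / sin b) ^ 3 * (3 * \<kappa> * (cos b / sin b * y - cos a / sin a * x) - S * (x + y))) (at 0)"
  unfolding lam12_coeff1_def
  apply (rule derivative_eq_intros refl | use sin_pos in force)+
  using sin_pos
  apply (simp add: S_def \<kappa>_def field_simps power2_eq_square power3_eq_cube)
  done

lemma lam12_coeff2_deriv:
  "((\<lambda>t. lam12_coeff2 (a + t * x) (b + t * y)) has_real_derivative
     (sin b / sin a) ^ 3 * (3 * \<kappa> * (cos b / sin b * y - cos a / sin a * x) + S * (x + y))) (at 0)"
  unfolding lam12_coeff2_def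
  apply (rule derivative_eq_intros refl | use sin_pos in force)+
  using sin_pos
  apply (simp add: S_def \<kappa>_def field_simps power2_eq_square power3_eq_cube)
  done

lemma lam12_coeff3_deriv:
  "\<exists>d. ((\<lambda>t. lam12_coeff3 (a + t * x) (b + t * y)) has_real_derivative d) (at 0)"
  unfolding lam12_coeff3_def using sin_pos
  by (intro exI) (rule derivative_eq_intros refl | force)+

text \<open>The ratio of the first two coefficients has nonzero speed along h = 0. With
  r = (sin b / sin a)^3, the two coefficients are -(1 + \<kappa> / r) and 1 + \<kappa> r, and the motion of r
  dominates that of \<kappa>: along the tangent, 3 \<kappa> L is \<kappa> times the logarithmic derivative of r and is
  less than -1, whereas the derivative of \<kappa>, which is S v, is at most 1 in absolute value.\<close>

lemma lam12_coeff_wedge: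
  assumes "((\<lambda>t. lam12_coeff1 (a + t * tangent1) (b + t * tangent2)) has_real_derivative d1) (at 0)"
    and "((\<lambda>t. lam12_coeff2 (a + t * tangent1) (b + t * tangent2)) has_real_derivative d2) (at 0)"
  shows "lam12_coeff2 a b * d1 - lam12_coeff1 a b * d2 < 0"
proof -
  define r where "r = (sin b / sin a) ^ 3"
  define L where "L = cos b / sin b * tangent2 - cos a / sin a * tangent1"
  define v where "v = tangent1 + tangent2"
  have r: "r > 0" "(sin a / sin b) ^ 3 = 1 / r"
    using sin_pos by (auto simp: r_def power_divide)
  have u: "lam12_coeff2 a b = 1 + \<kappa> * r" "lam12_coeff1 a b = - (1 + \<kappa> / r)"
    using r by (simp_all add: lam12_coeff1_def lam12_coeff2_def \<kappa>_def r_def[symmetric])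
  have d: "d1 = (1 / r) * (3 * \<kappa> * L - S * v)" "d2 = r * (3 * \<kappa> * L + S * v)"
    using DERIV_unique[OF assms(1) lam12_coeff1_deriv] DERIV_unique[OF assms(2) lam12_coeff2_deriv]
    unfolding r(2) L_def v_def r_def[symmetric] by auto
  have v: "v = - (W * s)" by (simp add: v_def tangent1_def tangent2_def field_simps)
  define p where "p = sin a * sin b"
  have p: "p > 0" "W * p = 2 * \<kappa> * S ^ 2"
    using sin_pos prod_sin by (auto simp: p_def)
  have Ls: "2 * p * L = - (W * s ^ 2 + S ^ 2 * (3 * W + 4 * \<kappa> * K))"
  proof -
    have "2 * p * L = 2 * (sin a * cos b * tangent2 - cos a * sin b * tangent1)"
      using sin_pos by (simp add: p_def L_def field_simps)
    also have "\<dots> = - (s * (W * s) + S * (S * (3 * W + 4 * \<kappa> * K)))"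
      unfolding tangent1_def tangent2_def s_def S_def sin_add[of a b] sin_diff[of a b] by (simp add: field_simps)
    finally show ?thesis by (simp add: power2_eq_square algebra_simps)
  qed
  have "3 * \<kappa> * L * (4 * S ^ 2) = 3 * W * (2 * p * L)"
    using p(2) by algebra
  also have "\<dots> \<le> 3 * W * (- (S ^ 2 * (3 * W)))"
  proof (rule mult_left_mono)
    have "0 \<le> W * s ^ 2" "0 \<le> S ^ 2 * (4 * \<kappa> * K)"
      using W_bound kappa_pos K_pos by (simp_all add: zero_le_mult_iff)
    then have "0 \<le> W * s ^ 2 + S ^ 2 * (4 * \<kappa> * K)" by (rule add_nonneg_nonneg)
    moreover have "2 * p * L = - (S ^ 2 * (3 * W)) - (W * s ^ 2 + S ^ 2 * (4 * \<kappa> * K))"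
      unfolding Ls by algebra
    ultimately show "2 * p * L \<le> - (S ^ 2 * (3 * W))" by linarith
  qed (use W_bound in simp)
  also have "\<dots> < - 4 * S ^ 2"
  proof -
    have "W * W > 7/9 * (7/9)" using W_bound by (intro mult_strict_mono) auto
    then have "S ^ 2 * (9 * (W * W)) > S ^ 2 * 4" using sin_pos(3) by (intro mult_strict_left_mono) auto
    then show ?thesis by (simp add: algebra_simps)
  qed
  finally have "3 * \<kappa> * L * (4 * S ^ 2) < - 4 * S ^ 2" .
  then have "(3 * \<kappa> * L + 1) * (4 * S ^ 2) < 0" unfolding distrib_right by linarith
  then have L: "3 * \<kappa> * L < - 1" using sin_pos(3) by (simp add: mult_less_0_iff)
  have "\<bar>S * v\<bar> \<le> 1"
  proof -
    have "\<bar>S\<bar> \<le> 1" "\<bar>s\<bar> \<le> 1" by (simp_all add: S_def s_def)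
    moreover have "\<bar>W\<bar> \<le> 1" using W_bound by (simp add: W_def)
    ultimately show ?thesis unfolding v by (simp add: abs_mult mult_le_one)
  qed
  have "lam12_coeff2 a b * d1 - lam12_coeff1 a b * d2 = S * v * (r - 1 / r) + 3 * \<kappa> * L * (r + 1 / r + 2 * \<kappa>)"
    using r(1) unfolding u d by (simp add: field_simps)
  also have "S * v * (r - 1 / r) \<le> 1 * (r + 1 / r)"
  proof -
    have "S * v * (r - 1 / r) \<le> \<bar>S * v\<bar> * \<bar>r - 1 / r\<bar>" by (metis abs_ge_self abs_mult)
    also have "\<dots> \<le> 1 * (r + 1 / r)"
      using \<open>\<bar>S * v\<bar> \<le> 1\<close> r(1) by (intro mult_mono) (auto simp: abs_le_iff)
    finally show ?thesis .
  qed
  also have "3 * \<kappa> * L * (r + 1 / r + 2 * \<kappa>) < (-1) * (r + 1 / r + 2 * \<kappa>)"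
    using L r(1) kappa_pos by (intro mult_strict_right_mono add_pos_pos) auto
  finally show ?thesis using kappa_pos by simp
qed

end

section \<open>Transversality of the Euler condition\<close>

definition cos_sin3 :: "real \<Rightarrow> real" where
  "cos_sin3 x = cos x * sin x ^ 3"

text \<open>The numerator of d after division by 2: with sin (2 x) sin^2 x = 2 cos x sin^3 x the denominators
  of d combine into sin^2 a sin^2 b sin^2 c. The argument c is kept separate so that the function is
  defined on all shapes.\<close>

definition meridian_d :: "real \<Rightarrow> real \<Rightarrow> real \<Rightarrow> real \<Rightarrow> real \<Rightarrow> real \<Rightarrow> real" where
  "meridian_d m1 m2 m3 a b c =
     m1 * (sin a ^ 2 * (cos_sin3 b - cos_sin3 c)) + m2 * (sin b ^ 2 * (cos_sin3 c - cos_sin3 a))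
      + m3 * (sin c ^ 2 * (cos_sin3 b - cos_sin3 a))"

lemma cos_sin3_deriv [derivative_intros]:
  assumes "(f has_real_derivative f') (at x)"
  shows "((\<lambda>x. cos_sin3 (f x)) has_real_derivative f' * (sin (f x) ^ 2 * (4 * cos (f x) ^ 2 - 1))) (at x)"
  unfolding cos_sin3_def
  apply (rule derivative_eq_intros assms refl)+
  apply simp
  using cos_squared_eq[of "f x"] by algebra

context bifurcation_shape
begin

text \<open>Off the curve both differences contain the additional term
  - \<kappa> (sin^4 a + sin^4 b - S^4).\<close>

lemma cos_sin3_diff_right:
  "S * (cos_sin3 b - cos_sin3 (a + b)) = sin a * (sin b ^ 3 + \<kappa> * sin a ^ 3)"
proof -
  have "S * cos b = sin a - \<kappa> * sin b"
    using sin_diff[of "a + b" b] by (simp add: S_def \<kappa>_def)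
  then show ?thesis
    using quartic unfolding cos_sin3_def S_def[symmetric] \<kappa>_def
    by simp algebra
qed

lemma cos_sin3_diff_left:
  "S * (cos_sin3 a - cos_sin3 (a + b)) = sin b * (sin a ^ 3 + \<kappa> * sin b ^ 3)"
proof -
  have "S * cos a = sin b - \<kappa> * sin a"
    using sin_diff[of "a + b" a] by (simp add: S_def \<kappa>_def)
  then show ?thesis
    using quartic unfolding cos_sin3_def S_def[symmetric] \<kappa>_def
    by simp algebra
qed

text \<open>On h = 0 the Euler condition and the condition \<lambda>_1 = \<lambda>_2 are the same linear equation in
  the masses, up to a nonzero factor.\<close>

lemma meridian_d_lam12:
  "S * meridian_d m1 m2 m3 a b (a + b) =
     - ((sin a * sin b) ^ 3 * (m1 * lam12_coeff1 a b + m2 * lam12_coeff2 a b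
        + m3 * lam12_coeff3 a b))"
proof -
  have "S * meridian_d m1 m2 m3 a b (a + b) =
     m1 * sin a ^ 2 * (S * (cos_sin3 b - cos_sin3 (a + b)))
     - m2 * sin b ^ 2 * (S * (cos_sin3 a - cos_sin3 (a + b)))
     + m3 * S ^ 3 * (cos_sin3 b - cos_sin3 a)"
    unfolding meridian_d_def S_def by algebra
  moreover have "(sin a * sin b) ^ 3 * lam12_coeff1 a b = - (sin a ^ 3 * (sin b ^ 3 + \<kappa> * sin a ^ 3))"
    "(sin a * sin b) ^ 3 * lam12_coeff2 a b = sin b ^ 3 * (sin a ^ 3 + \<kappa> * sin b ^ 3)"
    "(sin a * sin b) ^ 3 * lam12_coeff3 a b
       = S ^ 3 * (cos_sin3 a - cos_sin3 b)"
    unfolding lam12_coeff1_def lam12_coeff2_def lam12_coeff3_def cos_sin3_def \<kappa>_def S_def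
    using sin_pos by (simp_all add: power_divide power_mult_distrib field_simps)
  ultimately show ?thesis
    unfolding cos_sin3_diff_right cos_sin3_diff_left S_def[symmetric] by algebra
qed

text \<open>This decides the sign of the derivative of the mass coefficients of d on the extreme ray
  m_3 = 0. The derivative is taken at fixed a - b, at double speed, so that a, b and a + b change
  at rates 1, 1 and 2; G is the derivative of cos x sin^3 x. After symmetrisation everything is
  expressed by p = sin a sin b, q = sin^2 a + sin^2 b and the common factor s = sin (a - b),
  and p, q are rational in \<kappa>. The inequality becomes the negativity of a quartic in x = \<kappa>^2 for
  0 < x < 1/9.\<close>

lemma cos_sin3_wedge:
  assumes "b < a"
  defines "a1 \<equiv> cos_sin3 b - cos_sin3 (a + b)" and "b1 \<equiv> cos_sin3 a - cos_sin3 (a + b)"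
    and "G \<equiv> \<lambda>x. sin x ^ 2 * (4 * cos x ^ 2 - 1)"
  shows "(G b - 2 * G (a + b)) * b1 - (G a - 2 * G (a + b)) * a1 > 2 * s * a1 * b1 / (sin a * sin b)"
proof -
  define p q x where "p = sin a * sin b" and "q = sin a ^ 2 + sin b ^ 2" and "x = \<kappa> ^ 2"
  have p: "W * p = 2 * \<kappa> * S ^ 2" and q: "W * q = S ^ 2 * (1 + 2 * x)" and pp: "p > 0"
    using prod_sin sum_sin_squares sin_pos by (auto simp: p_def q_def x_def)
  have quart: "q ^ 2 = S ^ 4 + 2 * p ^ 2"
    unfolding quartic[symmetric] p_def q_def by algebra
  have s: "s > 0" using assms(1) pos unfolding s_def by (intro sin_gt_zero) auto
  have Sx: "S ^ 2 = 1 - x" and Wx: "W = 1 - 2 * x" and x: "0 < x" "x < 1 / 9"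
    using S_squared kappa_squared_less kappa_pos by (auto simp: x_def W_def)
  have Sp: "S > 0" by (rule sin_pos)
  have a1: "S * a1 = sin a * (sin b ^ 3 + \<kappa> * sin a ^ 3)"
   and b1: "S * b1 = sin b * (sin a ^ 3 + \<kappa> * sin b ^ 3)"
    unfolding a1_def b1_def by (rule cos_sin3_diff_right cos_sin3_diff_left)+
  have diff: "sin a ^ 2 - sin b ^ 2 = S * s" by (simp add: S_def s_def sin_squares_diff)
  have e: "b1 - a1 = \<kappa> * s * S ^ 2"
  proof -
    have "W * (p - \<kappa> * q) = W * p - \<kappa> * (W * q)" by algebra
    also have "\<dots> = W * (\<kappa> * S ^ 2)" unfolding p q unfolding Wx by algebra
    finally have "W * (p - \<kappa> * q) = W * (\<kappa> * S ^ 2)" .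
    then have pq: "p - \<kappa> * q = \<kappa> * S ^ 2" using W_bound by simp
    have "S * (b1 - a1) = S * b1 - S * a1" by algebra
    also have "\<dots> = (sin a ^ 2 - sin b ^ 2) * (p - \<kappa> * q)"
      unfolding a1 b1 p_def q_def by algebra
    finally have "S * (b1 - a1) = (sin a ^ 2 - sin b ^ 2) * (p - \<kappa> * q)" .
    then show ?thesis unfolding diff pq using Sp by simp
  qed
  have ab: "S ^ 2 * (a1 * b1) = p * (p ^ 3 * (1 + x) + \<kappa> * q * (q ^ 2 - 3 * p ^ 2))"
  proof -
    have "S ^ 2 * (a1 * b1) = (S * a1) * (S * b1)" by algebra
    then show ?thesis unfolding a1 b1 p_def q_def x_def by algebra
  qed
  have "S * (G a * a1 - G b * b1) = G a * (S * a1) - G b * (S * b1)" by algebra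
  also have "\<dots> = sin a ^ 3 * (4 * cos a ^ 2 - 1) * (sin b ^ 3 + \<kappa> * sin a ^ 3)
        - sin b ^ 3 * (4 * cos b ^ 2 - 1) * (sin a ^ 3 + \<kappa> * sin b ^ 3)"
    unfolding a1 b1 G_def by algebra
  also have "\<dots> = - 4 * p ^ 3 * (sin a ^ 2 - sin b ^ 2)
      + \<kappa> * (sin a ^ 2 - sin b ^ 2) * (3 * (q ^ 2 - p ^ 2) - 4 * q * (q ^ 2 - 2 * p ^ 2))"
    unfolding p_def q_def cos_squared_eq by algebra
  also have "\<dots> = S * (s * (- 4 * p ^ 3 + \<kappa> * (3 * (q ^ 2 - p ^ 2) - 4 * q * S ^ 4)))"
    unfolding diff quart by algebra
  finally have cross: "G a * a1 - G b * b1 =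
      s * (- 4 * p ^ 3 + \<kappa> * (3 * (q ^ 2 - p ^ 2) - 4 * q * S ^ 4))"
    using Sp by simp
  have Gc: "G (a + b) = S ^ 2 * (4 * x - 1)" by (simp add: G_def S_def \<kappa>_def x_def)
  \<comment> \<open>X is - S^2 / s times the difference of the two sides of the claim.\<close>
  define X where "X = 2 * (p ^ 3 * (1 + x) + \<kappa> * q * (q ^ 2 - 3 * p ^ 2))
     + S ^ 2 * (- 4 * p ^ 3 + \<kappa> * (3 * (q ^ 2 - p ^ 2) - 4 * q * S ^ 4)) - 2 * \<kappa> * S ^ 6 * (1 - 4 * x)"
  have "W ^ 3 * X = \<kappa> * S ^ 6 * (- 1 - 2 * x - 28 * x ^ 2 + 56 * x ^ 3 - 32 * x ^ 4)"
  proof -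
    have "W ^ 3 * X = 2 * ((W * p) ^ 3 * (1 + x) + \<kappa> * (W * q) * ((W * q) ^ 2 - 3 * (W * p) ^ 2))
     + S ^ 2 * (- 4 * (W * p) ^ 3 + \<kappa> * (3 * W * ((W * q) ^ 2 - (W * p) ^ 2) - 4 * W ^ 2 * (W * q) * S ^ 4))
     - 2 * \<kappa> * W ^ 3 * S ^ 6 * (1 - 4 * x)"
      unfolding X_def by algebra
    also have "\<dots> = \<kappa> * S ^ 6 * (2 * (8 * \<kappa> ^ 2 * (1 + x) + (1 + 2 * x) * ((1 + 2 * x) ^ 2 - 12 * \<kappa> ^ 2))
      - 32 * \<kappa> ^ 2 * S ^ 2 + 3 * W * ((1 + 2 * x) ^ 2 - 4 * \<kappa> ^ 2) - 4 * W ^ 2 * (1 + 2 * x) * S ^ 2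
      - 2 * W ^ 3 * (1 - 4 * x))"
      unfolding p q by algebra
    also have "2 * (8 * \<kappa> ^ 2 * (1 + x) + (1 + 2 * x) * ((1 + 2 * x) ^ 2 - 12 * \<kappa> ^ 2))
      - 32 * \<kappa> ^ 2 * S ^ 2 + 3 * W * ((1 + 2 * x) ^ 2 - 4 * \<kappa> ^ 2) - 4 * W ^ 2 * (1 + 2 * x) * S ^ 2
      - 2 * W ^ 3 * (1 - 4 * x) = - 1 - 2 * x - 28 * x ^ 2 + 56 * x ^ 3 - 32 * x ^ 4"
      unfolding Sx Wx x_def[symmetric] by algebra
    finally show ?thesis .
  qed
  moreover have "- 1 - 2 * x - 28 * x ^ 2 + 56 * x ^ 3 - 32 * x ^ 4 < 0"
  proof -
    have "56 * x ^ 3 \<le> 28 * x ^ 2" using x by (simp add: power2_eq_square power3_eq_cube)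
    moreover have "0 \<le> x ^ 4" by simp
    ultimately show ?thesis using x by linarith
  qed
  ultimately have "W ^ 3 * X < 0" using kappa_pos Sp by (simp add: mult_pos_neg)
  then have X: "X < 0" using W_bound by (simp add: mult_less_0_iff)
  have part: "S ^ 2 * (2 * s * (a1 * b1) / p) = 2 * s * (p ^ 3 * (1 + x) + \<kappa> * q * (q ^ 2 - 3 * p ^ 2))"
  proof -
    have "S ^ 2 * (2 * s * (a1 * b1) / p) = 2 * s * (S ^ 2 * (a1 * b1)) / p" by simp
    then show ?thesis unfolding ab using pp by simp
  qed
  have "(G b - 2 * G (a + b)) * b1 - (G a - 2 * G (a + b)) * a1
     = - (G a * a1 - G b * b1) - 2 * G (a + b) * (b1 - a1)" by algebra
  also have "\<dots> = - (s * (- 4 * p ^ 3 + \<kappa> * (3 * (q ^ 2 - p ^ 2) - 4 * q * S ^ 4)))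
      - 2 * (S ^ 2 * (4 * x - 1)) * (\<kappa> * s * S ^ 2)"
    unfolding cross Gc e ..
  finally have total: "(G b - 2 * G (a + b)) * b1 - (G a - 2 * G (a + b)) * a1 = \<dots>" .
  have "S ^ 2 * ((G b - 2 * G (a + b)) * b1 - (G a - 2 * G (a + b)) * a1 - 2 * s * (a1 * b1) / p) = - s * X"
    unfolding total right_diff_distrib[of "S ^ 2" _ "2 * s * (a1 * b1) / p"] part X_def by algebra
  then have "S ^ 2 * ((G b - 2 * G (a + b)) * b1 - (G a - 2 * G (a + b)) * a1 - 2 * s * (a1 * b1) / p) > 0"
    using s X by (simp add: mult_pos_neg)
  then show ?thesis using Sp by (simp add: zero_less_mult_iff p_def mult.assoc)
qed

text \<open>Let \<alpha>_i be the coefficients of the masses and \<beta>_i their derivatives. Since \<alpha>_1 > 0,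
  eliminating m_1 by d = 0 leaves a combination of m_2 and m_3 whose two coefficients are the
  wedges of (\<alpha>, \<beta>) on the extreme rays m_3 = 0 and m_2 = 0. Both are positive: the first by
  the preceding lemma, the second by the signs of the individual terms. For a < b the masses 1 and 2
  exchange roles; for a = b the derivative in this direction is zero.\<close>

lemma meridian_d_transversal:
  assumes "b < a" and m: "0 < m1" "0 < m2" "0 < m3"
    and zero: "meridian_d m1 m2 m3 a b (a + b) = 0"
  shows "\<exists>d. ((\<lambda>t. meridian_d m1 m2 m3 (a + t) (b + t) (a + b + 2 * t)) has_real_derivative d) (at 0) \<and> d \<noteq> 0"
proof -
  define G where "G x = sin x ^ 2 * (4 * cos x ^ 2 - 1)" for x :: real
  define a1 b1 e where "a1 = cos_sin3 b - cos_sin3 (a + b)" and "b1 = cos_sin3 a - cos_sin3 (a + b)"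
    and "e = cos_sin3 b - cos_sin3 a"
  define \<alpha>1 \<alpha>2 \<alpha>3 where \<alpha>: "\<alpha>1 = sin a ^ 2 * a1" "\<alpha>2 = - (sin b ^ 2 * b1)" "\<alpha>3 = S ^ 2 * e"
  define \<beta>1 where "\<beta>1 = 2 * sin a * cos a * a1 + sin a ^ 2 * (G b - 2 * G (a + b))"
  define \<beta>2 where "\<beta>2 = - (2 * sin b * cos b * b1 + sin b ^ 2 * (G a - 2 * G (a + b)))"
  define \<beta>3 where "\<beta>3 = - 4 * S * \<kappa> * e + S ^ 2 * (G b - G a)"
  define d where "d = m1 * \<beta>1 + m2 * \<beta>2 + m3 * \<beta>3"
  have der: "((\<lambda>t. meridian_d m1 m2 m3 (a + t) (b + t) (a + b + 2 * t)) has_real_derivative d) (at 0)"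
    unfolding meridian_d_def
    apply (rule derivative_eq_intros refl)+
    unfolding d_def \<beta>1_def \<beta>2_def \<beta>3_def a1_def b1_def e_def G_def S_def \<kappa>_def
    apply simp
    by algebra
  have s: "s > 0" using assms(1) pos unfolding s_def by (intro sin_gt_zero) auto
  have Sp: "S > 0" by (rule sin_pos)
  have pp: "sin a * sin b > 0" using sin_pos by simp
  have a1: "a1 > 0"
  proof -
    have "S * a1 > 0" unfolding a1_def cos_sin3_diff_right
      using sin_pos kappa_pos by (intro mult_pos_pos add_pos_pos) auto
    then show ?thesis using Sp by (simp add: zero_less_mult_iff)
  qed
  have "K > \<kappa>"
  proof -
    have "W * (K - \<kappa>) = 2 * \<kappa>" using W_K by (simp add: algebra_simps)
    then have "W * (K - \<kappa>) > 0" using kappa_pos by simp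
    then show ?thesis using W_bound by (simp add: zero_less_mult_iff)
  qed
  have kK: "\<kappa> * K < 1 / 2"
  proof -
    have "W * (\<kappa> * K) = \<kappa> ^ 2 * (2 + W)" using W_K by algebra
    also have "\<dots> \<le> \<kappa> ^ 2 * 3" by (intro mult_left_mono) (simp_all add: W_def)
    also have "\<dots> < W * (1 / 2)" using kappa_squared_less unfolding W_def by simp
    finally show ?thesis using W_bound by simp
  qed
  have diff: "sin a ^ 2 - sin b ^ 2 = S * s" by (simp add: S_def s_def sin_squares_diff)
  have Gdiff: "G b - G a = S * s * (1 + 4 * \<kappa> * K)"
  proof -
    have "G b - G a = (sin a ^ 2 - sin b ^ 2) * (4 * (sin a ^ 2 + sin b ^ 2) - 3)"
      unfolding G_def cos_squared_eq by algebra
    also have "\<dots> = S * s * (4 * (1 + \<kappa> * K) - 3)"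
      unfolding diff sin_squares_plane by (simp add: \<kappa>_def K_def)
    finally show ?thesis by simp
  qed
  have Gb: "G b > 0"
  proof -
    have "cos (2 * b) = cos ((a + b) - (a - b))" by simp
    also have "\<dots> = - (\<kappa> * K) + S * s" unfolding cos_diff[of "a + b"] by (simp add: \<kappa>_def K_def S_def s_def)
    finally have "4 * cos b ^ 2 - 1 = 1 - 2 * (\<kappa> * K) + 2 * (S * s)"
      using cos_double_cos[of b] by linarith
    moreover have "S * s > 0" using Sp s by simp
    ultimately have "4 * cos b ^ 2 - 1 > 0" using kK by linarith
    then show ?thesis unfolding G_def using sin_pos by simp
  qed
  have Gc: "G (a + b) < 0"
  proof -
    have "4 * cos (a + b) ^ 2 - 1 < 0" using kappa_squared_less by (simp add: \<kappa>_def)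
    then show ?thesis unfolding G_def using Sp by (simp add: S_def mult_pos_neg)
  qed
  have ca: "cos a > 0"
  proof -
    have ab: "cos a * cos b > 0"
      using \<open>K > \<kappa>\<close> by (simp add: cos_times_cos K_def \<kappa>_def)
    have "b < pi / 2" using assms(1) pos by linarith
    then have "cos b > 0" using pos by (intro cos_gt_zero) auto
    then show ?thesis using ab by (simp add: zero_less_mult_iff)
  qed
  have e: "e < 0"
  proof -
    have "S * e = S * a1 - S * b1" by (simp add: e_def a1_def b1_def algebra_simps)
    also have "\<dots> = - ((sin a ^ 2 - sin b ^ 2) * (sin a * sin b - \<kappa> * (sin a ^ 2 + sin b ^ 2)))"
      unfolding a1_def b1_def cos_sin3_diff_right cos_sin3_diff_left by algebra
    finally have eq: "S * e = - ((sin a ^ 2 - sin b ^ 2) * (sin a * sin b - \<kappa> * (sin a ^ 2 + sin b ^ 2)))" .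
    have "sin a * sin b - \<kappa> * (sin a ^ 2 + sin b ^ 2) = (K - \<kappa> - 2 * \<kappa> * (\<kappa> * K)) / 2"
      unfolding sin_times_sin sin_squares_plane by (simp add: K_def \<kappa>_def field_simps)
    also have "\<dots> = \<kappa> * (1 + W) / 2"
      unfolding right_diff_distrib W_def using W_K[unfolded W_def] by algebra
    finally have "S * e = - (S * s * (\<kappa> * (1 + W) / 2))" unfolding eq diff by simp
    moreover have "S * s * (\<kappa> * (1 + W) / 2) > 0" using Sp s kappa_pos W_bound by simp
    ultimately have "S * e < 0" by linarith
    then show ?thesis using Sp by (simp add: mult_less_0_iff)
  qed
  have B2: "\<alpha>1 * \<beta>2 - \<alpha>2 * \<beta>1 > 0"
  proof -
    have sc: "s = sin a * cos b - cos a * sin b" by (simp add: s_def sin_diff)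
    have "\<alpha>1 * \<beta>2 - \<alpha>2 * \<beta>1 = (sin a * sin b) ^ 2 *
       ((G b - 2 * G (a + b)) * b1 - (G a - 2 * G (a + b)) * a1) - 2 * s * a1 * b1 * (sin a * sin b)"
      unfolding \<alpha> \<beta>1_def \<beta>2_def sc by algebra
    also have "\<dots> = (sin a * sin b) ^ 2 *
       (((G b - 2 * G (a + b)) * b1 - (G a - 2 * G (a + b)) * a1) - 2 * s * a1 * b1 / (sin a * sin b))"
      using sin_pos by (simp add: field_simps power2_eq_square)
    also have "\<dots> > 0"
      using cos_sin3_wedge[OF assms(1)] pp
      unfolding a1_def b1_def G_def by (intro mult_pos_pos) auto
    finally show ?thesis .
  qed
  have B3: "\<alpha>1 * \<beta>3 - \<alpha>3 * \<beta>1 > 0"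
  proof -
    have b3: "\<beta>3 > 0"
    proof -
      have "S * \<kappa> * e < 0" using Sp kappa_pos e by (simp add: mult_pos_neg)
      moreover have "S ^ 2 * (G b - G a) > 0"
        unfolding Gdiff using Sp s kappa_pos K_pos by (simp add: add_pos_pos)
      ultimately show ?thesis unfolding \<beta>3_def by linarith
    qed
    have b1: "\<beta>1 > 0" unfolding \<beta>1_def
      using a1 ca sin_pos Gb Gc by (intro add_pos_pos mult_pos_pos) auto
    have "\<alpha>1 > 0" "\<alpha>3 < 0" unfolding \<alpha> using a1 e sin_pos by (auto simp: mult_pos_neg)
    then have "\<alpha>1 * \<beta>3 > 0" "\<alpha>3 * \<beta>1 < 0" using b3 b1 by (auto simp: mult_neg_pos)
    then show ?thesis by linarith
  qed
  have balance: "m1 * \<alpha>1 = - (m2 * \<alpha>2) - m3 * \<alpha>3"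
    using zero unfolding meridian_d_def \<alpha> a1_def b1_def e_def S_def by (simp add: algebra_simps)
  have "\<alpha>1 * d = m2 * (\<alpha>1 * \<beta>2 - \<alpha>2 * \<beta>1) + m3 * (\<alpha>1 * \<beta>3 - \<alpha>3 * \<beta>1)"
  proof -
    have "\<alpha>1 * d = m2 * (\<alpha>1 * \<beta>2) + m3 * (\<alpha>1 * \<beta>3) + (m1 * \<alpha>1) * \<beta>1" unfolding d_def by algebra
    then show ?thesis unfolding balance by algebra
  qed
  also have "\<dots> > 0" using B2 B3 m by (intro add_pos_pos mult_pos_pos)
  finally have "d \<noteq> 0" by auto
  with der show ?thesis by blast
qed

end

section \<open>The equilibrium conditions on the meridian plane\<close>

lemma open_shape_space: "open shape_space"
proof -
  have "shape_space = (\<Inter>i\<in>UNIV. {\<sigma>. 0 < \<sigma> $ i} \<inter> {\<sigma>. \<sigma> $ i < pi})"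
    by (auto simp: shape_space_def)
  also have "open \<dots>"
    by (intro open_INT ballI open_Int open_Collect_less continuous_intros finite_class.finite_UNIV)
  finally show ?thesis .
qed

lemma shape_space_sin_pos: "\<sigma> \<in> shape_space \<Longrightarrow> 0 < sin (\<sigma> $ i)"
  by (simp add: shape_space_def sin_gt_zero)

lemma meridian_plane_iff:
  "\<sigma> \<in> meridian_plane \<longleftrightarrow> 0 < \<sigma>$1 \<and> 0 < \<sigma>$2 \<and> \<sigma>$1 + \<sigma>$2 < pi \<and> \<sigma>$3 = \<sigma>$1 + \<sigma>$2"
  by (auto simp: meridian_plane_def shape_space_def forall_3)

lemma bif_h_meridian: "\<sigma> \<in> meridian_plane \<Longrightarrow> bif_h \<sigma> = meridian_h (\<sigma>$1) (\<sigma>$2)"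
  by (simp add: meridian_plane_def bif_h_def meridian_h_def)

lemma lam_C1: "C1_scalar_on (\<lambda>\<sigma>. lam m \<sigma> i j k) shape_space"
  unfolding lam_def
  by (rule C1_scalar_on_intros | simp add: shape_space_sin_pos[THEN less_imp_neq, symmetric])+

lemma lam12_C1: "C1_scalar_on (lam12 m) shape_space"
  unfolding lam12_def by (intro C1_scalar_on_diff lam_C1)

lemma lam23_C1: "C1_scalar_on (lam23 m) shape_space"
  unfolding lam23_def by (intro C1_scalar_on_diff lam_C1)

lemma lam12_meridian:
  assumes "\<sigma> \<in> meridian_plane"
  shows "lam12 m \<sigma> = m$1 * lam12_coeff1 (\<sigma>$1) (\<sigma>$2) + m$2 * lam12_coeff2 (\<sigma>$1) (\<sigma>$2)
    + m$3 * lam12_coeff3 (\<sigma>$1) (\<sigma>$2)"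
proof -
  have "\<sigma> \<in> shape_space" "\<sigma>$3 = \<sigma>$1 + \<sigma>$2" using assms by (auto simp: meridian_plane_def)
  then show ?thesis
    using shape_space_sin_pos[of \<sigma> 1] shape_space_sin_pos[of \<sigma> 2]
    unfolding lam12_def lam_def lam12_coeff1_def lam12_coeff2_def lam12_coeff3_def by (simp add: power_divide field_simps)
qed

text \<open>The pairing of the Lagrange equations with the kernel vector
  (sin \<sigma>_1, sin \<sigma>_2, - sin \<sigma>_3) of the Gram matrix: the weights sin^4 \<sigma>_i are the products of
  its entries with T_i. The identity is then rewritten in terms of \<lambda>_12, \<lambda>_23 and \<lambda>_2.\<close>

lemma weighted_lam_meridian:
  assumes "\<sigma> \<in> meridian_plane"
  shows "sin (\<sigma>$1) ^ 4 * lam12 m \<sigma> + sin (\<sigma>$3) ^ 4 * lam23 m \<sigma> =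
    (m$1 + m$2 + m$3 - lam m \<sigma> 2 3 1) * (sin (\<sigma>$1) * sin (\<sigma>$2) * bif_h \<sigma> / 2)"
proof -
  define a b c where "a = \<sigma>$1" and "b = \<sigma>$2" and "c = \<sigma>$3"
  have c: "c = a + b"
    using assms unfolding a_def b_def c_def by (auto simp: meridian_plane_def)
  have "\<sigma> \<in> shape_space" using assms by (auto simp: meridian_plane_def)
  then have s: "sin a \<noteq> 0" "sin b \<noteq> 0" "sin c \<noteq> 0"
    unfolding a_def b_def c_def by (simp_all add: shape_space_sin_pos[THEN less_imp_neq, symmetric])
  define l1 l2 l3 where "l1 = lam m \<sigma> 1 2 3" and "l2 = lam m \<sigma> 2 3 1" and "l3 = lam m \<sigma> 3 1 2"
  define M where "M = m$1 + m$2 + m$3"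
  have 1: "sin a ^ 4 * l1 = sin a * ((m$2 + m$3) * sin a ^ 3 - m$2 * cos c * sin b ^ 3 - m$3 * cos b * sin c ^ 3)"
   and 2: "sin b ^ 4 * l2 = sin b * ((m$3 + m$1) * sin b ^ 3 - m$3 * cos a * sin c ^ 3 - m$1 * cos c * sin a ^ 3)"
   and 3: "sin c ^ 4 * l3 = sin c * ((m$1 + m$2) * sin c ^ 3 - m$1 * cos b * sin a ^ 3 - m$2 * cos a * sin b ^ 3)"
    using s unfolding l1_def l2_def l3_def lam_def a_def b_def c_def
    by (simp_all add: eval_nat_numeral)
  have t: "sin c = sin a * cos b + cos a * sin b" "sin a = sin c * cos b - cos c * sin b"
      "sin b = sin c * cos a - cos c * sin a"
    using sin_add[of a b] sin_diff[of c b] sin_diff[of c a] by (auto simp: c)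
  have "sin a ^ 4 * l1 + sin b ^ 4 * l2 - sin c ^ 4 * l3 =
     m$1 * (sin b ^ 4 - sin c ^ 4 + sin a ^ 3 * (sin c * cos b - cos c * sin b))
     + m$2 * (sin a ^ 4 - sin c ^ 4 + sin b ^ 3 * (sin c * cos a - cos c * sin a))
     + m$3 * (sin a ^ 4 + sin b ^ 4 - sin c ^ 3 * (sin a * cos b + cos a * sin b))"
    unfolding 1 2 3 by algebra
  also have "\<dots> = M * (sin a ^ 4 + sin b ^ 4 - sin c ^ 4)"
    unfolding t[symmetric] M_def by algebra
  finally have "sin a ^ 4 * (l1 - l2) + sin c ^ 4 * (l2 - l3) = (M - l2) * (sin a ^ 4 + sin b ^ 4 - sin c ^ 4)"
    by algebra
  moreover have "sin a ^ 4 + sin b ^ 4 - sin c ^ 4 = sin a * sin b * bif_h \<sigma> / 2"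
    unfolding c bif_h_meridian[OF assms] using meridian_h_factor[of a b] by (simp add: a_def b_def)
  ultimately show ?thesis
    unfolding lam12_def lam23_def M_def l1_def l2_def l3_def a_def b_def c_def by simp
qed

text \<open>If \<lambda> were equal to the total mass, the vector (m_i sin^3 \<sigma>_i) would lie in the kernel of the
  Gram matrix, and its second and third entries would have opposite signs.\<close>

lemma lam_neq_total_mass:
  assumes "\<sigma> \<in> meridian_plane" "\<forall>i. 0 < m$i" "lam12 m \<sigma> = 0" "lam23 m \<sigma> = 0"
  shows "lam m \<sigma> 2 3 1 \<noteq> m$1 + m$2 + m$3"
proof
  assume eq: "lam m \<sigma> 2 3 1 = m$1 + m$2 + m$3"
  define a b c where "a = \<sigma>$1" and "b = \<sigma>$2" and "c = \<sigma>$3"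
  have c: "c = a + b"
    using assms unfolding a_def b_def c_def by (auto simp: meridian_plane_def)
  have "\<sigma> \<in> shape_space" using assms by (auto simp: meridian_plane_def)
  then have s: "sin a > 0" "sin b > 0" "sin c > 0"
    unfolding a_def b_def c_def by (simp_all add: shape_space_sin_pos)
  define y1 y2 y3 where "y1 = m$1 * sin a ^ 3" and "y2 = m$2 * sin b ^ 3" and "y3 = m$3 * sin c ^ 3"
  have y: "y2 > 0" "y3 > 0" using assms(2) s by (auto simp: y2_def y3_def)
  have l1: "lam m \<sigma> 1 2 3 = m$1 + m$2 + m$3" and l3: "lam m \<sigma> 3 1 2 = m$1 + m$2 + m$3"
    using assms(3,4) eq by (auto simp: lam12_def lam23_def)
  have g1: "y1 + cos c * y2 + cos b * y3 = 0" and g3: "y3 + cos b * y1 + cos a * y2 = 0"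
    using l1 l3 s unfolding lam_def y1_def y2_def y3_def a_def b_def c_def
    by (auto simp: field_simps)
  have "y3 * sin b ^ 2 = y3 - cos b * (cos b * y3)"
    unfolding sin_squared_eq by algebra
  also have "\<dots> = - ((cos a - cos c * cos b) * y2)"
    using g1 g3 by algebra
  also have "cos a - cos c * cos b = sin c * sin b"
    using cos_diff[of c b] by (simp add: c)
  finally have "y3 * sin b ^ 2 = - (sin c * sin b * y2)" .
  moreover have "y3 * sin b ^ 2 > 0" "sin c * sin b * y2 > 0" using y s by auto
  ultimately show False by linarith
qed

lemma ERE_d_meridian:
  assumes "\<sigma> \<in> meridian_plane"
  shows "ERE_d m \<sigma> = 2 * meridian_d (m$1) (m$2) (m$3) (\<sigma>$1) (\<sigma>$2) (\<sigma>$3) /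
     (sin (\<sigma>$1) * sin (\<sigma>$2) * sin (\<sigma>$3)) ^ 2"
proof -
  have "\<sigma> \<in> shape_space" using assms by (auto simp: meridian_plane_def)
  then show ?thesis
    using shape_space_sin_pos[of \<sigma> 1] shape_space_sin_pos[of \<sigma> 2] shape_space_sin_pos[of \<sigma> 3]
    unfolding ERE_d_def meridian_d_def cos_sin3_def sin_double
    by (simp add: field_simps eval_nat_numeral)
qed

text \<open>Identities that hold on the plane can thus be differentiated along in-plane lines.\<close>

lemma eventually_line_in_meridian_plane:
  assumes "p \<in> meridian_plane" "v$3 = v$1 + v$2"
  shows "\<forall>\<^sub>F t in nhds (0::real). p + t *\<^sub>R v \<in> meridian_plane"
proof -
  have "open ((\<lambda>t::real. p + t *\<^sub>R v) -` shape_space)"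
    by (intro open_vimage open_shape_space continuous_intros)
  then have "\<forall>\<^sub>F t in nhds (0::real). p + t *\<^sub>R v \<in> shape_space"
    using assms(1) eventually_nhds_in_open[of "(\<lambda>t::real. p + t *\<^sub>R v) -` shape_space" 0]
    by (simp add: meridian_plane_def)
  then show ?thesis
    by eventually_elim (use assms in \<open>auto simp: meridian_plane_def algebra_simps\<close>)
qed

lemma bifurcation_shape_point:
  assumes "p \<in> meridian_plane" "bif_h p = 0"
  shows "bifurcation_shape (p$1) (p$2)"
  using assms bif_h_meridian[OF assms(1)] unfolding bifurcation_shape_def by (auto simp: meridian_plane_iff)

lemma bif_h_zero_of_lam_zero:
  assumes "p \<in> meridian_plane" "\<forall>i. 0 < m$i" "lam12 m p = 0" "lam23 m p = 0"
  shows "bif_h p = 0"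
proof -
  have "p \<in> shape_space" using assms(1) by (simp add: meridian_plane_def)
  then have "sin (p$1) \<noteq> 0" "sin (p$2) \<noteq> 0"
    by (simp_all add: shape_space_sin_pos[THEN less_imp_neq, symmetric])
  then show ?thesis
    using weighted_lam_meridian[OF assms(1), of m] lam_neq_total_mass[OF assms] assms(3,4) by auto
qed

lemma lam23_zero_of_lam12_zero:
  assumes "p \<in> meridian_plane" "bif_h p = 0" "lam12 m p = 0"
  shows "lam23 m p = 0"
proof -
  have "p \<in> shape_space" using assms(1) by (simp add: meridian_plane_def)
  then have "sin (p$3) \<noteq> 0"
    by (simp add: shape_space_sin_pos[THEN less_imp_neq, symmetric])
  then show ?thesis
    using weighted_lam_meridian[OF assms(1), of m] assms(2,3) by simp
qed

text \<open>Differentiating the paired identity at a common zero of \<lambda>_12, \<lambda>_23 and h: only the terms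
  survive in which the vanishing factor is differentiated.\<close>

lemma weighted_lam_derivative:
  assumes p: "p \<in> meridian_plane" "bif_h p = 0" "lam12 m p = 0"
    and v: "v$3 = v$1 + v$2"
    and x: "((\<lambda>t. lam12 m (p + t *\<^sub>R v)) has_real_derivative x) (at 0)"
    and y: "((\<lambda>t. lam23 m (p + t *\<^sub>R v)) has_real_derivative y) (at 0)"
    and h: "((\<lambda>t. meridian_h (p$1 + t * v$1) (p$2 + t * v$2)) has_real_derivative d) (at 0)"
  shows "sin (p$1) ^ 4 * x + sin (p$3) ^ 4 * y =
     (m$1 + m$2 + m$3 - lam m p 2 3 1) * (sin (p$1) * sin (p$2) / 2) * d"
proof -
  define \<Phi> where "\<Phi> t = (m$1 + m$2 + m$3 - lam m (p + t *\<^sub>R v) 2 3 1)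
     * (sin (p$1 + t * v$1) * sin (p$2 + t * v$2) / 2)" for t
  have ps: "p \<in> shape_space" using p(1) by (simp add: meridian_plane_def)
  obtain l where l: "((\<lambda>t. lam m (p + t *\<^sub>R v) 2 3 1) has_real_derivative l) (at 0)"
    using C1_scalar_on_directional_derivative[OF lam_C1 ps] by blast
  have "\<exists>\<phi>. (\<Phi> has_real_derivative \<phi>) (at 0)"
    unfolding \<Phi>_def by (rule exI) (rule derivative_eq_intros l refl | simp)+
  then obtain \<phi> where \<phi>: "(\<Phi> has_real_derivative \<phi>) (at 0)" by blast
  have h0: "meridian_h (p$1) (p$2) = 0" using bif_h_meridian[OF p(1)] p(2) by simp
  have R: "((\<lambda>t. \<Phi> t * meridian_h (p$1 + t * v$1) (p$2 + t * v$2)) has_real_derivative \<Phi> 0 * d) (at 0)"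
    using DERIV_mult[OF \<phi> h] h0 by (simp add: mult.commute)
  have l23: "lam23 m p = 0" by (rule lam23_zero_of_lam12_zero[OF p])
  have s1: "((\<lambda>t. sin (p$1 + t * v$1) ^ 4) has_real_derivative 4 * sin (p$1) ^ 3 * (cos (p$1) * v$1)) (at 0)"
   and s3: "((\<lambda>t. sin (p$3 + t * v$3) ^ 4) has_real_derivative 4 * sin (p$3) ^ 3 * (cos (p$3) * v$3)) (at 0)"
    by (auto intro!: derivative_eq_intros)
  have L: "((\<lambda>t. sin (p$1 + t * v$1) ^ 4 * lam12 m (p + t *\<^sub>R v) + sin (p$3 + t * v$3) ^ 4 * lam23 m (p + t *\<^sub>R v))
     has_real_derivative sin (p$1) ^ 4 * x + sin (p$3) ^ 4 * y) (at 0)"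
    using DERIV_add[OF DERIV_mult[OF s1 x] DERIV_mult[OF s3 y]] p(3) l23 by (simp add: mult.commute)
  have "\<forall>\<^sub>F t in nhds 0. sin (p$1 + t * v$1) ^ 4 * lam12 m (p + t *\<^sub>R v) + sin (p$3 + t * v$3) ^ 4 * lam23 m (p + t *\<^sub>R v)
     = \<Phi> t * meridian_h (p$1 + t * v$1) (p$2 + t * v$2)"
    using eventually_line_in_meridian_plane[OF p(1) v]
  proof eventually_elim
    case (elim t)
    show ?case
      using weighted_lam_meridian[OF elim, of m] bif_h_meridian[OF elim] by (simp add: \<Phi>_def)
  qed
  from DERIV_cong_ev[OF refl this refl] L R
  have "sin (p$1) ^ 4 * x + sin (p$3) ^ 4 * y = \<Phi> 0 * d"
    using DERIV_unique by blast
  then show ?thesis by (simp add: \<Phi>_def)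
qed

lemma lam12_derivative:
  assumes p: "p \<in> meridian_plane" and v: "v$3 = v$1 + v$2"
    and "((\<lambda>t. lam12_coeff1 (p$1 + t * v$1) (p$2 + t * v$2)) has_real_derivative d1) (at 0)"
    and "((\<lambda>t. lam12_coeff2 (p$1 + t * v$1) (p$2 + t * v$2)) has_real_derivative d2) (at 0)"
    and "((\<lambda>t. lam12_coeff3 (p$1 + t * v$1) (p$2 + t * v$2)) has_real_derivative d3) (at 0)"
  shows "((\<lambda>t. lam12 m (p + t *\<^sub>R v)) has_real_derivative m$1 * d1 + m$2 * d2 + m$3 * d3) (at 0)"
proof -
  have "\<forall>\<^sub>F t in nhds 0. lam12 m (p + t *\<^sub>R v) =
     m$1 * lam12_coeff1 (p$1 + t * v$1) (p$2 + t * v$2) + m$2 * lam12_coeff2 (p$1 + t * v$1) (p$2 + t * v$2)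
      + m$3 * lam12_coeff3 (p$1 + t * v$1) (p$2 + t * v$2)"
    using eventually_line_in_meridian_plane[OF p v]
    by eventually_elim (simp add: lam12_meridian)
  from DERIV_cong_ev[OF refl this refl] show ?thesis
    by (simp only:) (intro DERIV_add DERIV_cmult assms)
qed

section \<open>Continuations and bifurcation points\<close>

text \<open>For v tangent to h = 0 the differentiated identity has right-hand side 0, and for a direction
  transversal to h = 0 it is nonzero. Together they express the minor of (\<lambda>_12, \<lambda>_23) as a nonzero
  multiple of x.\<close>

lemma LRE_continuation_exists:
  assumes p: "p \<in> meridian_plane" "bif_h p = 0" and m: "\<forall>i. 0 < m$i" and l12: "lam12 m p = 0"
    and v: "v$3 = v$1 + v$2"
    and tangent: "((\<lambda>t. meridian_h (p$1 + t * v$1) (p$2 + t * v$2)) has_real_derivative 0) (at 0)"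
    and x: "((\<lambda>t. lam12 m (p + t *\<^sub>R v)) has_real_derivative x) (at 0)" and "x \<noteq> 0"
  shows "\<exists>\<gamma> I. LRE_continuation m \<gamma> I \<and> p \<in> \<gamma> ` I"
proof -
  interpret bifurcation_shape "p$1" "p$2" by (rule bifurcation_shape_point[OF p])
  have ps: "p \<in> shape_space" using p(1) by (simp add: meridian_plane_def)
  have l23: "lam23 m p = 0" by (rule lam23_zero_of_lam12_zero[OF p l12])
  \<comment> \<open>The derivative of h at fixed difference of the first two angles is positive on the curve.\<close>
  define w :: "real^3" where "w = vector [1, 1, 2]"
  have w: "w$3 = w$1 + w$2" "w$1 = 1" "w$2 = 1" by (simp_all add: w_def)
  obtain y where y: "((\<lambda>t. lam23 m (p + t *\<^sub>R v)) has_real_derivative y) (at 0)"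
    using C1_scalar_on_directional_derivative[OF lam23_C1 ps] by blast
  obtain x' where x': "((\<lambda>t. lam12 m (p + t *\<^sub>R w)) has_real_derivative x') (at 0)"
    using C1_scalar_on_directional_derivative[OF lam12_C1 ps] by blast
  obtain y' where y': "((\<lambda>t. lam23 m (p + t *\<^sub>R w)) has_real_derivative y') (at 0)"
    using C1_scalar_on_directional_derivative[OF lam23_C1 ps] by blast
  define d where "d = 4 * (S * (3 * W + 4 * \<kappa> * K))"
  have d: "((\<lambda>t. meridian_h (p$1 + t * w$1) (p$2 + t * w$2)) has_real_derivative d) (at 0)"
    using meridian_h_deriv[of 1 1] by (simp add: w d_def)
  have "d > 0"
    unfolding d_def using sin_pos W_bound kappa_pos K_pos by (intro mult_pos_pos add_pos_pos) auto
  define R where "R = (m$1 + m$2 + m$3 - lam m p 2 3 1) * (sin (p$1) * sin (p$2) / 2)"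
  have "R \<noteq> 0"
    using lam_neq_total_mass[OF p(1) m l12 l23] sin_pos by (simp add: R_def)
  have e1: "sin (p$1) ^ 4 * x + sin (p$3) ^ 4 * y = 0"
    using weighted_lam_derivative[OF p l12 v x y tangent] by simp
  have e2: "sin (p$1) ^ 4 * x' + sin (p$3) ^ 4 * y' = R * d"
    using weighted_lam_derivative[OF p l12 w(1) x' y' d] by (simp add: R_def)
  have "sin (p$3) ^ 4 * (x * y' - y * x') = R * d * x"
    using e1 e2 by algebra
  moreover have "R * d * x \<noteq> 0" using \<open>R \<noteq> 0\<close> \<open>d > 0\<close> \<open>x \<noteq> 0\<close> by simp
  ultimately have "x * y' - y * x' \<noteq> 0" by auto
  from regular_curve_through_common_zero[OF open_shape_space ps lam12_C1 lam23_C1 l12 l23 x y x' y' this]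
  show ?thesis unfolding LRE_continuation_def by blast
qed

lemma meridian_d_C1: "C1_scalar_on (\<lambda>\<sigma>. meridian_d m1 m2 m3 (\<sigma>$1) (\<sigma>$2) (\<sigma>$3)) U"
  unfolding meridian_d_def cos_sin3_def by (rule C1_scalar_on_intros)+

lemma ERE_continuation_transversal:
  assumes p: "p \<in> meridian_plane" and zero: "meridian_d (m$1) (m$2) (m$3) (p$1) (p$2) (p$3) = 0"
    and d: "((\<lambda>t. meridian_d (m$1) (m$2) (m$3) (p$1 + t) (p$2 + t) (p$3 + 2 * t)) has_real_derivative d) (at 0)"
      "d \<noteq> 0"
  shows "\<exists>\<gamma> I. ERE_continuation m \<gamma> I \<and> p \<in> \<gamma> ` I"
proof -
  have ps: "p \<in> shape_space" using p by (simp add: meridian_plane_def)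
  define f where "f \<sigma> = meridian_d (m$1) (m$2) (m$3) (\<sigma>$1) (\<sigma>$2) (\<sigma>$3)" for \<sigma> :: "real^3"
  define g where "g \<sigma> = \<sigma>$3 - \<sigma>$1 - \<sigma>$2" for \<sigma> :: "real^3"
  \<comment> \<open>The first direction lies in the plane, the second one leaves it; so the minor reduces to d.\<close>
  define v w :: "real^3" where "v = vector [1, 1, 2]" and "w = axis 3 1"
  have f: "C1_scalar_on f shape_space" unfolding f_def by (rule meridian_d_C1)
  have g: "C1_scalar_on g shape_space" unfolding g_def by (rule C1_scalar_on_intros)+
  have fv: "((\<lambda>t. f (p + t *\<^sub>R v)) has_real_derivative d) (at 0)"
    using d(1) by (simp add: f_def v_def mult.commute)
  have gv: "((\<lambda>t. g (p + t *\<^sub>R v)) has_real_derivative 0) (at 0)"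
    unfolding g_def v_def by (auto intro!: derivative_eq_intros)
  have gw: "((\<lambda>t. g (p + t *\<^sub>R w)) has_real_derivative 1) (at 0)"
    unfolding g_def w_def by (auto intro!: derivative_eq_intros simp: axis_def)
  obtain b where fw: "((\<lambda>t. f (p + t *\<^sub>R w)) has_real_derivative b) (at 0)"
    using C1_scalar_on_directional_derivative[OF f ps] by blast
  have "f p = 0" "g p = 0" using zero p by (auto simp: f_def g_def meridian_plane_def)
  from regular_curve_through_common_zero[OF open_shape_space ps f g this fv gv fw gw]
  obtain \<gamma> I where c: "regular_C1_curve \<gamma> I" "\<gamma> ` I \<subseteq> shape_space" "p \<in> \<gamma> ` I"
    "\<forall>t\<in>I. f (\<gamma> t) = 0 \<and> g (\<gamma> t) = 0" using d(2) by auto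
  have "\<gamma> t \<in> meridian_plane \<and> ERE_d m (\<gamma> t) = 0" if "t \<in> I" for t
  proof
    show "\<gamma> t \<in> meridian_plane" using c that by (force simp: meridian_plane_def g_def)
    then show "ERE_d m (\<gamma> t) = 0" using c(4) that by (simp add: ERE_d_meridian f_def)
  qed
  then show ?thesis unfolding ERE_continuation_def using c by blast
qed

lemma meridian_d_swap: "meridian_d m1 m2 m3 a b c = - meridian_d m2 m1 m3 b a c"
  unfolding meridian_d_def by algebra

text \<open>Here the derivative of d at the point may vanish, but reflection symmetry makes every
  isosceles shape a solution.\<close>

lemma ERE_continuation_isosceles:
  assumes p: "p \<in> meridian_plane" "p$1 = p$2" and m: "m$1 = m$2"
  shows "\<exists>\<gamma> I. ERE_continuation m \<gamma> I \<and> p \<in> \<gamma> ` I"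
proof -
  define v :: "real^3" where "v = vector [1, 1, 2]"
  define \<gamma> where "\<gamma> t = p + t *\<^sub>R v" for t
  define I where "I = {- p$1 <..< pi / 2 - p$1}"
  have der: "(\<gamma> has_vector_derivative v) (at t)" for t
    unfolding \<gamma>_def by (auto intro!: derivative_eq_intros)
  have "v \<noteq> 0" by (auto simp: v_def vec_eq_iff forall_3)
  then have "vector_derivative \<gamma> (at t) \<noteq> 0" for t
    using vector_derivative_at[OF der] by simp
  moreover have "\<gamma> C1_differentiable_on I"
    unfolding C1_differentiable_on_def using der by (intro exI[of _ "\<lambda>_. v"]) auto
  moreover have "0 \<in> I" using p by (auto simp: I_def meridian_plane_iff)
  ultimately have "regular_C1_curve \<gamma> I"
    unfolding regular_C1_curve_def by (auto simp: I_def is_interval_oo)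
  moreover have "\<gamma> t \<in> meridian_plane" if "t \<in> I" for t
    using that p by (auto simp: meridian_plane_iff \<gamma>_def v_def I_def)
  moreover have "ERE_d m (\<gamma> t) = 0" if "t \<in> I" for t
    using p m by (simp add: ERE_d_def \<gamma>_def v_def)
  moreover have "\<gamma> 0 = p" by (simp add: \<gamma>_def)
  ultimately show ?thesis
    unfolding ERE_continuation_def using \<open>0 \<in> I\<close> by blast
qed

lemma ERE_continuation_exists:
  assumes p: "p \<in> meridian_plane" "bif_h p = 0" and m: "\<forall>i. 0 < m$i" and l12: "lam12 m p = 0"
  shows "\<exists>\<gamma> I. ERE_continuation m \<gamma> I \<and> p \<in> \<gamma> ` I"
proof -
  interpret bifurcation_shape "p$1" "p$2" by (rule bifurcation_shape_point[OF p])
  have p3: "p$3 = p$1 + p$2" using p(1) by (simp add: meridian_plane_def)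
  have "S * meridian_d (m$1) (m$2) (m$3) (p$1) (p$2) (p$1 + p$2) = 0"
    using l12 unfolding meridian_d_lam12 lam12_meridian[OF p(1)] by simp
  then have zero: "meridian_d (m$1) (m$2) (m$3) (p$1) (p$2) (p$1 + p$2) = 0"
    using sin_pos by simp
  consider "p$2 < p$1" | "p$1 < p$2" | "p$1 = p$2" by linarith
  then show ?thesis
  proof cases
    case 1
    from meridian_d_transversal[OF 1 _ _ _ zero] m show ?thesis
      using ERE_continuation_transversal[OF p(1), of m] zero by (auto simp: p3)
  next
    case 2
    interpret swapped: bifurcation_shape "p$2" "p$1"
      by (rule bifurcation_shape_swap[OF bifurcation_shape_axioms])
    have "meridian_d (m$2) (m$1) (m$3) (p$2) (p$1) (p$2 + p$1) = 0"
      using zero meridian_d_swap[of "m$1" "m$2" "m$3" "p$1" "p$2"] by (simp add: add.commute)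
    from swapped.meridian_d_transversal[OF 2 _ _ _ this] m
    obtain d where d: "((\<lambda>t. meridian_d (m$2) (m$1) (m$3) (p$2 + t) (p$1 + t) (p$2 + p$1 + 2 * t)) has_real_derivative d) (at 0)"
      "d \<noteq> 0" by blast
    have "((\<lambda>t. meridian_d (m$1) (m$2) (m$3) (p$1 + t) (p$2 + t) (p$3 + 2 * t)) has_real_derivative - d) (at 0)"
      unfolding meridian_d_swap[of "m$1"] p3 add.commute[of "p$1" "p$2"] by (intro DERIV_minus d)
    then show ?thesis
      using ERE_continuation_transversal[OF p(1), of m "- d"] zero d(2) by (simp add: p3)
  next
    case 3
    define G where "G = sin (p$1) ^ 2 * (cos_sin3 (p$1) - cos_sin3 (p$1 + p$2))"
    have "S * (cos_sin3 (p$1) - cos_sin3 (p$1 + p$2)) > 0"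
      unfolding cos_sin3_diff_left using sin_pos kappa_pos by (intro mult_pos_pos add_pos_pos) auto
    then have "G \<noteq> 0" using sin_pos by (auto simp: G_def)
    moreover have "(m$1 - m$2) * G = 0"
      using zero 3 unfolding meridian_d_def G_def by (simp add: algebra_simps)
    ultimately show ?thesis
      using ERE_continuation_isosceles[OF p(1) 3] by simp
  qed
qed

text \<open>On the line U1 x + U2 y + U3 = 0 the function d1 x + d2 y + d3 is affine in y with
  a negative slope, since this slope is the wedge divided by - U1. Hence x and y are
  positive and the function is negative as soon as y is large, and a segment of that part of the
  line is the required curve.\<close>

lemma mass_ratio_family:
  fixes U1 U2 U3 d1 d2 d3 :: real
  assumes U: "U1 < 0" "0 < U2" and wedge: "U2 * d1 - U1 * d2 < 0"
  shows "\<exists>\<nu> :: real \<Rightarrow> real \<times> real. regular_C1_curve \<nu> {0<..<1} \<and> inj_on \<nu> {0<..<1} \<and>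
           (\<forall>s\<in>{0<..<1}. 0 < fst (\<nu> s) \<and> 0 < snd (\<nu> s) \<and>
              fst (\<nu> s) * U1 + snd (\<nu> s) * U2 + U3 = 0 \<and> fst (\<nu> s) * d1 + snd (\<nu> s) * d2 + d3 \<noteq> 0)"
proof -
  define k l where "k = - U2 / U1" and "l = - U3 / U1"
  have k: "k > 0" "k * U1 = - U2" "l * U1 = - U3" using U by (auto simp: k_def l_def divide_pos_neg)
  define \<omega> where "\<omega> = - (k * d1 + d2)"
  have "U1 * \<omega> = U2 * d1 - U1 * d2" using k(2) unfolding \<omega>_def by algebra
  then have "U1 * \<omega> < 0" using wedge by simp
  then have \<omega>: "\<omega> > 0" using U by (simp add: mult_less_0_iff)
  \<comment> \<open>Beyond B the second ratio, the first ratio and the sign of the affine function are all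
      under control; the three entries are the thresholds in this order.\<close>
  define B where "B = Max {0, - l / k, (l * d1 + d3) / \<omega>}"
  define \<nu> where "\<nu> s = (k * (B + s) + l, B + s)" for s
  have der: "(\<nu> has_vector_derivative (k, 1)) (at s)" for s
    unfolding \<nu>_def by (auto intro!: derivative_eq_intros)
  have "regular_C1_curve \<nu> {0<..<1}"
    unfolding regular_C1_curve_def C1_differentiable_on_def
    using vector_derivative_at[OF der] der
    by (auto simp: is_interval_oo zero_prod_def intro!: exI[of _ "\<lambda>_. (k, 1)"])
  moreover have "inj_on \<nu> {0<..<1}" by (auto simp: inj_on_def \<nu>_def)
  moreover have "0 < fst (\<nu> s) \<and> 0 < snd (\<nu> s) \<and>
      fst (\<nu> s) * U1 + snd (\<nu> s) * U2 + U3 = 0 \<and> fst (\<nu> s) * d1 + snd (\<nu> s) * d2 + d3 \<noteq> 0"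
    if "s \<in> {0<..<1}" for s
  proof -
    define n where "n = B + s"
    have "B < n" using that by (simp add: n_def)
    then have n: "0 < n" "- l / k < n" "(l * d1 + d3) / \<omega> < n" by (auto simp: B_def)
    have "(k * n + l) * U1 + n * U2 + U3 = 0" using k by algebra
    moreover have "0 < k * n + l" using n(2) k by (simp add: field_simps)
    moreover have "(k * n + l) * d1 + n * d2 + d3 = (l * d1 + d3) - n * \<omega>" unfolding \<omega>_def by algebra
    moreover have "l * d1 + d3 < n * \<omega>" using n(3) \<omega> by (simp add: field_simps)
    ultimately show ?thesis using n(1) by (simp add: \<nu>_def n_def[symmetric])
  qed
  ultimately show ?thesis by blast
qed

lemma continuum_of_bifurcating_mass_ratios:
  assumes p: "p \<in> meridian_plane" "bif_h p = 0"
  shows "\<exists>\<nu> :: real \<Rightarrow> real \<times> real. regular_C1_curve \<nu> {0<..<1} \<and> inj_on \<nu> {0<..<1} \<and>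
           (\<forall>s\<in>{0<..<1}. 0 < fst (\<nu> s) \<and> 0 < snd (\<nu> s) \<and>
              (\<forall>m\<in>masses_with_ratios (\<nu> s). bifurcation_point m p))"
proof -
  interpret bifurcation_shape "p$1" "p$2" by (rule bifurcation_shape_point[OF p])
  define v :: "real^3" where "v = vector [tangent1, tangent2, tangent1 + tangent2]"
  have v: "v$3 = v$1 + v$2" "v$1 = tangent1" "v$2 = tangent2" by (simp_all add: v_def)
  define U1 U2 U3 where "U1 = lam12_coeff1 (p$1) (p$2)" and "U2 = lam12_coeff2 (p$1) (p$2)" and "U3 = lam12_coeff3 (p$1) (p$2)"
  obtain d1 d2 d3 where
    d: "((\<lambda>t. lam12_coeff1 (p$1 + t * v$1) (p$2 + t * v$2)) has_real_derivative d1) (at 0)"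
       "((\<lambda>t. lam12_coeff2 (p$1 + t * v$1) (p$2 + t * v$2)) has_real_derivative d2) (at 0)"
       "((\<lambda>t. lam12_coeff3 (p$1 + t * v$1) (p$2 + t * v$2)) has_real_derivative d3) (at 0)"
    using lam12_coeff1_deriv[of tangent1 tangent2] lam12_coeff2_deriv[of tangent1 tangent2] lam12_coeff3_deriv[of tangent1 tangent2] unfolding v by blast
  have "U2 * d1 - U1 * d2 < 0"
    unfolding U1_def U2_def using lam12_coeff_wedge[OF d(1,2)[unfolded v(2,3)]] .
  moreover have "U1 < 0" "0 < U2"
  proof -
    have "0 < \<kappa> * (sin (p$1) / sin (p$2)) ^ 3" "0 < \<kappa> * (sin (p$2) / sin (p$1)) ^ 3"
      using kappa_pos sin_pos by simp_all
    then show "U1 < 0" "0 < U2" by (simp_all add: U1_def U2_def lam12_coeff1_def lam12_coeff2_def \<kappa>_def)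
  qed
  ultimately obtain \<nu> :: "real \<Rightarrow> real \<times> real" where \<nu>: "regular_C1_curve \<nu> {0<..<1}" "inj_on \<nu> {0<..<1}"
    "\<And>s. s \<in> {0<..<1} \<Longrightarrow> 0 < fst (\<nu> s) \<and> 0 < snd (\<nu> s) \<and>
       fst (\<nu> s) * U1 + snd (\<nu> s) * U2 + U3 = 0 \<and> fst (\<nu> s) * d1 + snd (\<nu> s) * d2 + d3 \<noteq> 0"
    using mass_ratio_family[of U1 U2 d1 d2 U3 d3] by blast
  have "bifurcation_point m p" if s: "s \<in> {0<..<1}" and m: "m \<in> masses_with_ratios (\<nu> s)" for s m
  proof -
    have pos: "\<forall>i. 0 < m$i" and m3: "m$3 \<noteq> 0" and
      ratios: "m$1 = fst (\<nu> s) * m$3" "m$2 = snd (\<nu> s) * m$3"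
      using m unfolding masses_with_ratios_def by (auto simp: field_simps less_imp_neq[symmetric])
    have "lam12 m p = m$3 * (fst (\<nu> s) * U1 + snd (\<nu> s) * U2 + U3)"
      unfolding lam12_meridian[OF p(1)] U1_def U2_def U3_def ratios by (simp add: algebra_simps)
    then have l12: "lam12 m p = 0" using \<nu>(3)[OF s] by simp
    have "m$1 * d1 + m$2 * d2 + m$3 * d3 = m$3 * (fst (\<nu> s) * d1 + snd (\<nu> s) * d2 + d3)"
      unfolding ratios by (simp add: algebra_simps)
    then have "m$1 * d1 + m$2 * d2 + m$3 * d3 \<noteq> 0" using \<nu>(3)[OF s] m3 by simp
    from LRE_continuation_exists[OF p pos l12 v(1) _ lam12_derivative[OF p(1) v(1) d] this]
    show ?thesis
      unfolding bifurcation_point_def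
      using meridian_h_tangent ERE_continuation_exists[OF p pos l12] p(1) by (simp add: v)
  qed
  then show ?thesis using \<nu> by blast
qed

theorem theorem2:
  shows "(\<forall>p \<in> meridian_plane. bif_h p = 0 \<longrightarrow>
            (\<exists>\<nu> :: real \<Rightarrow> real \<times> real.
               regular_C1_curve \<nu> {0<..<1} \<and> inj_on \<nu> {0<..<1} \<and>
               (\<forall>s \<in> {0<..<1}. 0 < fst (\<nu> s) \<and> 0 < snd (\<nu> s) \<and>
                  (\<forall>m \<in> masses_with_ratios (\<nu> s). bifurcation_point m p))))
       \<and> (\<forall>\<nu> :: real \<times> real. 0 < fst \<nu> \<and> 0 < snd \<nu> \<longrightarrow>
            (\<forall>m \<in> masses_with_ratios \<nu>. \<forall>\<gamma> I. \<forall>t \<in> I.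
               LRE_continuation m \<gamma> I \<and> \<gamma> t \<in> meridian_plane \<longrightarrow>
                 bif_h (\<gamma> t) = 0 \<and> bifurcation_point m (\<gamma> t)))"
proof (intro conjI ballI impI allI)
  fix p :: "real^3" assume "p \<in> meridian_plane" "bif_h p = 0"
  then show "\<exists>\<nu> :: real \<Rightarrow> real \<times> real. regular_C1_curve \<nu> {0<..<1} \<and> inj_on \<nu> {0<..<1} \<and>
      (\<forall>s \<in> {0<..<1}. 0 < fst (\<nu> s) \<and> 0 < snd (\<nu> s) \<and>
         (\<forall>m \<in> masses_with_ratios (\<nu> s). bifurcation_point m p))"
    by (rule continuum_of_bifurcating_mass_ratios)
next
  fix \<nu> m \<gamma> I and t :: real
  assume m: "m \<in> masses_with_ratios \<nu>" and t: "t \<in> I"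
    and "LRE_continuation m \<gamma> I \<and> \<gamma> t \<in> meridian_plane"
  then have L: "LRE_continuation m \<gamma> I" and p: "\<gamma> t \<in> meridian_plane" by auto
  have pos: "\<forall>i. 0 < m$i" using m by (simp add: masses_with_ratios_def)
  have l: "lam12 m (\<gamma> t) = 0" "lam23 m (\<gamma> t) = 0" using L t by (auto simp: LRE_continuation_def)
  show h: "bif_h (\<gamma> t) = 0" by (rule bif_h_zero_of_lam_zero[OF p pos l])
  show "bifurcation_point m (\<gamma> t)"
    unfolding bifurcation_point_def
    using p L t ERE_continuation_exists[OF p h pos l(1)] by blast
qed

end
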